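(* Let $n\in\mathbb{N}$ and, for $j=1,\dots,n$, let $\Lambda_j=(\lambda_{j,m})_{m\in\mathbb{N}}$ be a lacunary sequence of positive integers with ratio $\rho_{\Lambda_j}\ge 2$. Let $(k_1,\dots,k_n)$ be a given $n$-tuple of positive integers. Then there are positive constants $A$ and $B$, depending only on $\Lambda_1^{(k_1)},\dots,\Lambda_n^{(k_n)}$, such that for every $f\in L\log^{K_n/2}L(\mathbb{T}^n)$, $$\Big(\sum_{(m_1,\dots,m_n)\in\Lambda_1^{(k_1)}\times\cdots\times\Lambda_n^{(k_n)}}|\widehat{f}(m_1,\dots,m_n)|^2\Big)^{1/2}\le A\int_{\mathbb{T}^n}|f(\underline{\theta})|\log^{K_n/2}(1+|f(\underline{\theta})|)\,d\underline{\theta}+B,$$ where $K_n=k_1+\cdots+k_n$.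
   Context: A sequence $\Lambda=(\lambda_m)_{m\in\mathbb{N}}$ of positive integers is lacunary if its ratio $\rho_\Lambda:=\inf_{m\in\mathbb{N}}\lambda_{m+1}/\lambda_m$ satisfies $\rho_\Lambda>1$. For $k\ge1$, $\Lambda^{(k)}:=\{\pm\lambda_{m_1}\pm\cdots\pm\lambda_{m_k}: m_1>\cdots>m_k\}\subset\mathbb{Z}$ (all choices of signs). $L\log^{r}L(\mathbb{T}^n)$ is the space of measurable $f$ on $\mathbb{T}^n$ with $\int_{\mathbb{T}^n}|f|\log^{r}(1+|f|)<\infty$. *)

theory Defs
  imports "HOL-Analysis.Analysis"
begin

definition lacunary_ratio :: "(nat \<Rightarrow> nat) \<Rightarrow> real" where
  "lacunary_ratio lam = (INF m. real (lam (Suc m)) / real (lam m))"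

definition lacunary :: "(nat \<Rightarrow> nat) \<Rightarrow> bool" where
  "lacunary lam \<longleftrightarrow> (\<forall>m. 0 < lam m) \<and> 1 < lacunary_ratio lam"

definition signed_sums :: "(nat \<Rightarrow> nat) \<Rightarrow> nat \<Rightarrow> int set" where
  "signed_sums lam k =
     {\<Sum>i<k. \<epsilon> i * int (lam (m i)) | \<epsilon> m.
        (\<forall>i<k. \<epsilon> i \<in> {1, -1}) \<and> strict_antimono_on {..<k} m}"

text \<open>
  The torus is \<open>(\<real>/\<int>)\<^sup>n\<close>, represented by its fundamental domain \<open>[0,1)\<^sup>n\<close> with Lebesgue
  measure, i.e. normalised Haar measure. Functions on the torus are functions on this cube
  (values outside it are irrelevant below), and the characters are
  \<open>\<theta> \<mapsto> exp (2 \<pi> i m \<cdot> \<theta>)\<close>.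
\<close>

definition torus :: "(real ^ 'n) measure" where
  "torus = lebesgue_on {\<theta>. \<forall>j. 0 \<le> \<theta> $ j \<and> \<theta> $ j < 1}"

definition fourier_coeff :: "(real ^ 'n \<Rightarrow> complex) \<Rightarrow> int ^ 'n \<Rightarrow> complex" where
  "fourier_coeff f m =
     (LINT \<theta>|torus. f \<theta> * exp (- 2 * of_real pi * \<i> * of_real (\<Sum>j\<in>UNIV. of_int (m $ j) * \<theta> $ j)))"

definition LlogL :: "real \<Rightarrow> (real ^ 'n \<Rightarrow> complex) set" where
  "LlogL r = {f \<in> borel_measurable torus.
     integrable torus (\<lambda>\<theta>. norm (f \<theta>) * ln (1 + norm (f \<theta>)) powr r)}"

end

theory Submission
  imports Defs
begin

text \<open>
  By duality it suffices to bound the even moments of trigonometric polynomials \<open>P\<close> with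
  frequencies in the given set by \<open>(C i ^ K) ^ i\<close> when \<open>P\<close> is normalised in \<open>L\<^sup>2\<close>, since
  these moments control the exponential term in a Young inequality for \<open>\<bar>f\<bar> \<bar>P\<bar>\<close>.

  For sums of at most \<open>K\<close> elements of a dissociated family such moment bounds follow from Bonami's
  hypercontractive inequality: put a random sign in front of every element of the family, and
  remove the signs again by convolving with a Riesz product, which is a positive kernel of mass one.

  A sequence of ratio \<open>2\<close> need not be dissociated. A signed sum of at most \<open>K\<close> terms is a signed
  digit expansion; for at least one of \<open>2 K + 1\<close> offsets, the expansion splits into well
  separated blocks of length at most \<open>2 K - 1\<close>. If all digits are chosen at random, the resulting
  block sums form a dissociated family, and a fixed frequency is a sum of at most \<open>K\<close> of them
  with probability bounded below. Averaging over the choices gives the theorem.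
\<close>

section \<open>Characters of the torus\<close>

text \<open>The exponent K/2 is dictated by the degree. For degree K, Bonami's inequality lets the
  L^(2i) norm of P grow like i^(K/2), which amounts to exponential integrability of |P|^(2/K); the
  Young dual of that is L log^(K/2) L. Dissociation makes the Fourier coefficient of a Riesz product
  at a subset sum come from a single term, so that it carries exactly the sign to be removed. For
  lambda_m = 2^m it fails: lambda_(m+1) - lambda_m = lambda_m. Separated blocks cure this, but every
  frequency prescribes its own digits inside a block, so no single family of block sums serves all
  frequencies. Random digits do: a frequency meets at most K blocks of at most 2K+1 positions each,
  so the digits there are the right ones with probability at least 3^(-K(2K+1)), uniformly in the
  frequency. Growth of the block sums by a factor 3 already suffices for dissociation: the two
  representations to be compared have coefficients in {-1, 0, 1} and {0, 1}, which differ by at most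
  2, and 2(1/3 + 1/9 + ...) = 1.\<close>

lemma lborel_integral_prod_Basis:
  fixes f :: "'a::euclidean_space \<Rightarrow> real \<Rightarrow> complex"
  assumes "\<And>b. b \<in> Basis \<Longrightarrow> integrable lborel (f b)"
  shows "(LINT x|lborel. (\<Prod>b\<in>Basis. f b (x \<bullet> b))) = (\<Prod>b\<in>Basis. (LINT t|lborel. f b t))"
proof -
  interpret product_sigma_finite "\<lambda>_::'a. lborel :: real measure" ..
  have [measurable]: "f b \<in> borel_measurable borel" if "b \<in> Basis" for b
    using borel_measurable_integrable[OF assms[OF that]] by simp
  have "(LINT x|lborel. (\<Prod>b\<in>Basis. f b (x \<bullet> b))) =
    (LINT x|distr (\<Pi>\<^sub>M b\<in>Basis. lborel) borel (\<lambda>g. \<Sum>b\<in>Basis. g b *\<^sub>R b). (\<Prod>b\<in>Basis. f b ((x::'a) \<bullet> b)))"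
    by (subst lborel_eq) simp
  also have "\<dots> = (LINT g|(\<Pi>\<^sub>M b\<in>(Basis::'a set). lborel). (\<Prod>b\<in>Basis. f b ((\<Sum>b\<in>Basis. g b *\<^sub>R b) \<bullet> b)))"
    by (rule integral_distr) measurable
  also have "\<dots> = (LINT g|(\<Pi>\<^sub>M b\<in>(Basis::'a set). lborel). (\<Prod>b\<in>Basis. f b (g b)))"
    by simp
  also have "\<dots> = (\<Prod>b\<in>Basis. (LINT t|lborel. f b t))"
    by (rule product_integral_prod) (auto intro: assms)
  finally show ?thesis .
qed

lemma measurable_cis [measurable]: "cis \<in> borel_measurable borel"
  by (intro borel_measurable_continuous_onI continuous_intros)

lemma integrable_indicator_cis:
  "integrable lborel (\<lambda>t. indicator {0..<1::real} t *\<^sub>R cis (c * t))"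
  by (rule integrableI_bounded_set_indicator[where B = 1]) auto

lemma lborel_integral_cis:
  fixes k :: int
  shows "(LINT t|lborel. indicator {0..<1::real} t *\<^sub>R cis (2 * pi * of_int k * t)) = of_bool (k = 0)"
proof (cases "k = 0")
  case True
  have "(LINT t|lborel. indicator {0..<1::real} t *\<^sub>R (1::complex)) = 1"
    by (subst integral_scaleR_left) auto
  with True show ?thesis by simp
next
  case False
  let ?c = "2 * pi * of_int k"
  have c: "?c \<noteq> 0" using False by simp
  have der: "((\<lambda>t. cis (?c * t) / (\<i> * of_real ?c)) has_vector_derivative cis (?c * t)) (at t within {0..1})" for t
  proof -
    have "((\<lambda>t. cis (?c * t)) has_vector_derivative ?c *\<^sub>R (\<i> * cis (?c * t))) (at t within {0..1})"
      unfolding cis_conv_exp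
      by (rule derivative_eq_intros has_vector_derivative_real_field refl | simp add: scaleR_conv_of_real)+
    then have "((\<lambda>t. cis (?c * t) / (\<i> * of_real ?c)) has_vector_derivative
        (?c *\<^sub>R (\<i> * cis (?c * t))) / (\<i> * of_real ?c)) (at t within {0..1})"
      by (intro has_vector_derivative_divide)
    moreover have "(?c *\<^sub>R (\<i> * cis (?c * t))) / (\<i> * of_real ?c) = cis (?c * t)"
      using c by (simp add: scaleR_conv_of_real)
    ultimately show ?thesis by simp
  qed
  have "(LINT t|lborel. indicator {0..<1::real} t *\<^sub>R cis (?c * t)) =
      (LINT t|lborel. indicator {0..1::real} t *\<^sub>R cis (?c * t))"
  proof (rule integral_cong_AE)
    show "AE t in lborel. indicat_real {0..<1} t *\<^sub>R cis (?c * t) = indicat_real {0..1} t *\<^sub>R cis (?c * t)"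
      using AE_lborel_singleton[of "1::real"] by eventually_elim (auto simp: indicator_def)
  qed measurable
  also have "\<dots> = cis (?c * 1) / (\<i> * of_real ?c) - cis (?c * 0) / (\<i> * of_real ?c)"
    by (rule integral_FTC_Icc) (auto intro!: der continuous_intros simp del: of_real_mult)
  also have "\<dots> = 0"
    by (simp add: cis_multiple_2pi)
  finally show ?thesis using False by simp
qed

definition torus_char :: "int ^ 'n \<Rightarrow> real ^ 'n \<Rightarrow> complex" where
  "torus_char m \<theta> = cis (2 * pi * (\<Sum>j\<in>UNIV. of_int (m $ j) * \<theta> $ j))"

lemma torus_char_0 [simp]: "torus_char 0 \<theta> = 1"
  by (simp add: torus_char_def)

lemma torus_char_add: "torus_char (m + l) \<theta> = torus_char m \<theta> * torus_char l \<theta>"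
  by (simp add: torus_char_def cis_mult ring_distribs sum.distrib)

lemma torus_char_minus: "torus_char (- m) \<theta> = cnj (torus_char m \<theta>)"
  by (simp add: torus_char_def cis_cnj sum_negf)

lemma torus_char_sum: "torus_char (\<Sum>x\<in>X. u x) \<theta> = (\<Prod>x\<in>X. torus_char (u x) \<theta>)"
  by (induction X rule: infinite_finite_induct) (auto simp: torus_char_add)

lemma torus_char_diff_right: "torus_char m (\<theta> - \<psi>) = torus_char m \<theta> * cnj (torus_char m \<psi>)"
  by (simp add: torus_char_def cis_cnj cis_mult ring_distribs sum_subtractf)

lemma norm_torus_char [simp]: "norm (torus_char m \<theta>) = 1"
  by (simp add: torus_char_def)

section \<open>The torus as a probability space; orthogonality of characters\<close>

lemma measurable_lebesgue_on_borel:
  "g \<in> borel_measurable borel \<Longrightarrow> g \<in> borel_measurable (lebesgue_on S)"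
  by (simp add: measurable_completion measurable_restrict_space1)

lemma measurable_torus_char [measurable]: "torus_char m \<in> borel_measurable torus"
  unfolding torus_def
proof (rule measurable_lebesgue_on_borel)
  show "torus_char m \<in> borel_measurable borel"
    unfolding torus_char_def by measurable
qed

lemma emeasure_torus_space: "emeasure (torus :: (real^'n) measure) (space torus) < \<infinity>"
proof -
  let ?Q = "{\<theta> :: real^'n. \<forall>j. 0 \<le> \<theta> $ j \<and> \<theta> $ j < 1}"
  have Q: "?Q \<in> sets borel" by measurable
  have "emeasure torus (space (torus :: (real^'n) measure)) = emeasure lborel ?Q"
    using Q unfolding torus_def by (simp add: emeasure_restrict_space)
  also have "\<dots> \<le> emeasure lborel (cbox (0::real^'n) 1)"
    by (rule emeasure_mono) (auto simp: mem_box_cart less_imp_le)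
  also have "\<dots> < \<infinity>" by (rule emeasure_lborel_cbox_finite)
  finally show ?thesis .
qed

interpretation torus: finite_measure "torus :: (real^'n) measure"
  by (intro finite_measureI) (metis emeasure_torus_space infinity_ennreal_def less_irrefl)

text \<open>The cube is a product and the character factors over the coordinates, so the integral is
  a product of one-dimensional integrals over [0,1).\<close>

lemma integral_torus_char:
  fixes m :: "int ^ 'n"
  shows "(LINT \<theta>|torus. torus_char m \<theta>) = of_bool (m = 0)"
proof -
  let ?Q = "{\<theta> :: real^'n. \<forall>j. 0 \<le> \<theta> $ j \<and> \<theta> $ j < 1}"
  let ?N = "\<chi> j. real_of_int (m $ j)"
  have Q: "?Q \<in> sets borel" by measurable
  have [measurable]: "torus_char m \<in> borel_measurable borel"
    unfolding torus_char_def by measurable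
  have ind: "indicator ?Q x *\<^sub>R torus_char m x =
      (\<Prod>b\<in>Basis. indicator {0..<1::real} (x \<bullet> b) *\<^sub>R cis (2 * pi * (?N \<bullet> b) * (x \<bullet> b)))" for x
  proof -
    have Q': "x \<in> ?Q \<longleftrightarrow> (\<forall>b\<in>Basis. x \<bullet> b \<in> {0..<1})"
      by (auto simp: Basis_vec_def inner_axis)
    have "(\<Prod>b\<in>Basis. cis (2 * pi * (?N \<bullet> b) * (x \<bullet> b))) = cis (\<Sum>b\<in>Basis. 2 * pi * (?N \<bullet> b) * (x \<bullet> b))"
      unfolding cis_conv_exp by (simp add: exp_sum sum_distrib_left)
    also have "(\<Sum>b\<in>Basis. 2 * pi * (?N \<bullet> b) * (x \<bullet> b)) = 2 * pi * (?N \<bullet> x)"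
      by (subst euclidean_inner[of ?N x]) (simp add: sum_distrib_left mult.assoc)
    also have "cis (2 * pi * (?N \<bullet> x)) = torus_char m x"
      by (simp add: torus_char_def inner_vec_def)
    finally have *: "(\<Prod>b\<in>Basis. cis (2 * pi * (?N \<bullet> b) * (x \<bullet> b))) = torus_char m x" .
    show ?thesis
    proof (cases "x \<in> ?Q")
      case True
      then have "\<forall>b\<in>Basis. x \<bullet> b \<in> {0..<1}" using Q' by blast
      then have "(\<Prod>b\<in>Basis. indicator {0..<1::real} (x \<bullet> b) *\<^sub>R cis (2 * pi * (?N \<bullet> b) * (x \<bullet> b)))
         = (\<Prod>b\<in>Basis. cis (2 * pi * (?N \<bullet> b) * (x \<bullet> b)))"
        by (intro prod.cong) auto
      with True * show ?thesis by simp
    next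
      case False
      then obtain b where "b \<in> Basis" "x \<bullet> b \<notin> {0..<1}" using Q' by blast
      then have "(\<Prod>b\<in>Basis. indicator {0..<1::real} (x \<bullet> b) *\<^sub>R cis (2 * pi * (?N \<bullet> b) * (x \<bullet> b))) = 0"
        by (intro prod_zero) (auto intro!: bexI[of _ b])
      with False show ?thesis by simp
    qed
  qed
  have "(LINT \<theta>|torus. torus_char m \<theta>) = (LINT x|lebesgue. indicator ?Q x *\<^sub>R torus_char m x)"
    unfolding torus_def by (rule integral_restrict_space) (use Q in auto)
  also have "\<dots> = (LINT x|lborel. indicator ?Q x *\<^sub>R torus_char m x)"
    by (rule integral_completion) (use Q in measurable)
  also have "\<dots> = (\<Prod>b\<in>(Basis::(real^'n) set). (LINT t|lborel. indicator {0..<1::real} t *\<^sub>R cis (2 * pi * (?N \<bullet> b) * t)))"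
    unfolding ind by (intro lborel_integral_prod_Basis integrable_indicator_cis)
  also have "\<dots> = (\<Prod>b\<in>(Basis::(real^'n) set). of_bool (?N \<bullet> b = 0))"
  proof (rule prod.cong[OF refl])
    fix b :: "real^'n" assume "b \<in> Basis"
    then obtain j where "b = axis j 1" by (auto simp: Basis_vec_def)
    then have "?N \<bullet> b = of_int (m $ j)" by (simp add: inner_axis)
    then show "(LINT t|lborel. indicator {0..<1::real} t *\<^sub>R cis (2 * pi * (?N \<bullet> b) * t)) = of_bool (?N \<bullet> b = 0)"
      using lborel_integral_cis[of "m $ j"] by simp
  qed
  also have "\<dots> = of_bool (m = 0)"
  proof (cases "m = 0")
    case False
    then obtain j where "m $ j \<noteq> 0" by (auto simp: vec_eq_iff)
    then have "?N \<bullet> axis j 1 \<noteq> 0" by (simp add: inner_axis)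
    then have "(\<Prod>b\<in>(Basis::(real^'n) set). of_bool (?N \<bullet> b = 0)) = (0::complex)"
      by (intro prod_zero) (auto intro!: bexI[of _ "axis j 1"])
    with False show ?thesis by simp
  qed (simp add: inner_vec_def)
  finally show ?thesis .
qed

lemma measure_torus_space [simp]: "measure torus (space (torus :: (real^'n) measure)) = 1"
  using integral_torus_char[of "0 :: int^'n"] by (simp add: of_real_eq_1_iff scaleR_conv_of_real)

lemma integrable_torus_char [simp]: "integrable torus (torus_char m)"
  by (rule torus.integrable_const_bound[where B = 1]) auto

lemma fourier_coeff_torus_char:
  "fourier_coeff f m = (LINT \<theta>|torus. f \<theta> * cnj (torus_char m \<theta>))"
proof -
  have "exp (- 2 * of_real pi * \<i> * of_real (\<Sum>j\<in>UNIV. of_int (m $ j) * \<theta> $ j)) = cnj (torus_char m \<theta>)" for \<theta>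
    unfolding torus_char_def cis_cnj by (simp add: cis_conv_exp mult_ac)
  then show ?thesis unfolding fourier_coeff_def by presburger
qed

section \<open>Hypercontractivity on the discrete cube\<close>

text \<open>Odd powers of \<open>w\<close> cancel in the average, so only the square of
  \<open>w\<close> matters. The averages \<open>E\<close> and the companion \<open>H\<close> obey a
  linear recursion; the hypothesis trades the square of \<open>w\<close> for one factor
  \<open>u\<close>, which is absorbed by \<open>u * E i\<close> being at most
  \<open>E (Suc i)\<close>. Hence passing from \<open>E i\<close> to \<open>E (Suc i)\<close> costs
  at most a factor u + 4 i y^2.\<close>

lemma two_point_power_le:
  fixes u w y :: real
  assumes "0 \<le> u" "w\<^sup>2 \<le> 4 * u * y\<^sup>2"
  shows "((u + w) ^ n + (u - w) ^ n) / 2 \<le> (u + 4 * real n * y\<^sup>2) ^ n"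
proof -
  define E where "E i = ((u + w) ^ i + (u - w) ^ i) / 2" for i
  define H where "H i = w * ((u + w) ^ i - (u - w) ^ i) / 2" for i
  have E_Suc: "E (Suc i) = u * E i + H i" for i
    by (simp add: E_def H_def field_simps)
  have H_Suc: "H (Suc i) = u * H i + w\<^sup>2 * E i" for i
    by (simp add: E_def H_def field_simps power2_eq_square)
  have nonneg: "0 \<le> E i \<and> 0 \<le> H i" for i
  proof (induction i)
    case 0 show ?case by (simp add: E_def H_def)
  next
    case (Suc i) with assms(1) show ?case by (simp add: E_Suc H_Suc)
  qed
  have uE: "u * E i \<le> E (Suc i)" for i
    using nonneg[of i] by (simp add: E_Suc)
  have H_le: "H (Suc i) \<le> real (Suc i) * w\<^sup>2 * E i" for i
  proof (induction i)
    case 0 show ?case by (simp add: E_def H_def power2_eq_square)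
  next
    case (Suc i)
    have "H (Suc (Suc i)) \<le> u * (real (Suc i) * w\<^sup>2 * E i) + w\<^sup>2 * E (Suc i)"
      unfolding H_Suc[of "Suc i"] using Suc assms(1) by (intro add_right_mono mult_left_mono)
    also have "u * (real (Suc i) * w\<^sup>2 * E i) = real (Suc i) * w\<^sup>2 * (u * E i)" by simp
    also have "\<dots> \<le> real (Suc i) * w\<^sup>2 * E (Suc i)"
      by (intro mult_left_mono uE) auto
    finally show ?case by (simp add: algebra_simps)
  qed
  have step: "E (Suc i) \<le> (u + 4 * real i * y\<^sup>2) * E i" for i
  proof (cases i)
    case 0 then show ?thesis by (simp add: E_def)
  next
    case (Suc l)
    have "H i \<le> real i * w\<^sup>2 * E l" using H_le[of l] Suc by simp
    also have "\<dots> \<le> real i * (4 * u * y\<^sup>2) * E l"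
      using nonneg[of l] assms(2) by (intro mult_right_mono mult_left_mono) auto
    also have "\<dots> = 4 * real i * y\<^sup>2 * (u * E l)" by simp
    also have "\<dots> \<le> 4 * real i * y\<^sup>2 * E i"
      unfolding Suc by (intro mult_left_mono uE) auto
    finally show ?thesis by (simp add: E_Suc algebra_simps)
  qed
  have "E i \<le> (u + 4 * real n * y\<^sup>2) ^ i" if "i \<le> n" for i
    using that
  proof (induction i)
    case 0 show ?case by (simp add: E_def)
  next
    case (Suc i)
    have "E (Suc i) \<le> (u + 4 * real i * y\<^sup>2) * E i" by (rule step)
    also have "\<dots> \<le> (u + 4 * real n * y\<^sup>2) * (u + 4 * real n * y\<^sup>2) ^ i"
      using Suc assms(1) nonneg[of i] by (intro mult_mono add_left_mono mult_right_mono) auto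
    finally show ?case by simp
  qed
  then show ?thesis by (simp add: E_def)
qed

text \<open>Here |g + h|^2 and |g - h|^2 are u + w and u - w with u = |g|^2 + |h|^2 and w = 2 Re (g
  cnj h), and |w| is at most 2 |g| |h|. The factor 4n comes from the two-point bound, the extra 1
  from the |h|^2 inside u. Only its linear growth in n matters later.\<close>

lemma two_point_complex:
  fixes g h :: complex
  shows "(norm (g + h) ^ (2 * n) + norm (g - h) ^ (2 * n)) / 2
    \<le> ((norm g)\<^sup>2 + (4 * real n + 1) * (norm h)\<^sup>2) ^ n"
proof -
  define u where "u = (norm g)\<^sup>2 + (norm h)\<^sup>2"
  define w where "w = 2 * Re (g * cnj h)"
  have "\<bar>Re (g * cnj h)\<bar> \<le> norm g * norm h"
    using abs_Re_le_cmod[of "g * cnj h"] by (simp add: norm_mult)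
  then have "(Re (g * cnj h))\<^sup>2 \<le> (norm g * norm h)\<^sup>2"
    by (metis abs_ge_zero power2_abs power_mono)
  moreover have "(norm g * norm h)\<^sup>2 \<le> u * (norm h)\<^sup>2"
    unfolding power_mult_distrib by (intro mult_right_mono) (auto simp: u_def)
  moreover have "w\<^sup>2 = 4 * (Re (g * cnj h))\<^sup>2"
    unfolding w_def power_mult_distrib by simp
  ultimately have w: "w\<^sup>2 \<le> 4 * u * (norm h)\<^sup>2"
    by linarith
  have "(norm (g + h))\<^sup>2 = u + w" "(norm (g - h))\<^sup>2 = u - w"
    by (simp_all add: u_def w_def cmod_power2) (simp_all add: power2_eq_square algebra_simps)
  then have "(norm (g + h) ^ (2 * n) + norm (g - h) ^ (2 * n)) / 2 = ((u + w) ^ n + (u - w) ^ n) / 2"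
    by (simp add: power_mult)
  also have "\<dots> \<le> (u + 4 * real n * (norm h)\<^sup>2) ^ n"
    by (rule two_point_power_le[OF _ w]) (simp add: u_def)
  finally show ?thesis by (simp add: u_def algebra_simps)
qed

lemma convex_power_nonneg: "convex_on {0::real..} (\<lambda>x. x ^ n)"
  using convex_on_subset[OF convex_power_even] convex_power_odd by (cases "even n") auto

text \<open>Minkowski's inequality for the l^n norm in root-free form: convexity of the n-th power
  with weights a/(a+b) and b/(a+b).\<close>

lemma sum_power_add_le:
  fixes X Y :: "'a \<Rightarrow> real"
  assumes "\<And>x. x \<in> S \<Longrightarrow> 0 \<le> X x" "\<And>x. x \<in> S \<Longrightarrow> 0 \<le> Y x" "0 < a" "0 < b" "0 \<le> c"
    and "(\<Sum>x\<in>S. X x ^ n) \<le> c * a ^ n" "(\<Sum>x\<in>S. Y x ^ n) \<le> c * b ^ n"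
  shows "(\<Sum>x\<in>S. (X x + Y x) ^ n) \<le> c * (a + b) ^ n"
proof -
  have "(X x + Y x) ^ n \<le> (a + b) ^ n * (a / (a + b) * (X x / a) ^ n + b / (a + b) * (Y x / b) ^ n)"
    if x: "x \<in> S" for x
  proof -
    have "(a / (a + b) * (X x / a) + b / (a + b) * (Y x / b)) ^ n
      \<le> a / (a + b) * (X x / a) ^ n + b / (a + b) * (Y x / b) ^ n"
      using convex_onD[OF convex_power_nonneg, of "b / (a + b)" "X x / a" "Y x / b" n] assms x
      by (simp add: field_simps)
    moreover have "a / (a + b) * (X x / a) + b / (a + b) * (Y x / b) = (X x + Y x) / (a + b)"
      using assms by (simp add: add_divide_distrib)
    ultimately have "((X x + Y x) / (a + b)) ^ n \<le> a / (a + b) * (X x / a) ^ n + b / (a + b) * (Y x / b) ^ n"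
      by simp
    then have "(a + b) ^ n * ((X x + Y x) / (a + b)) ^ n
       \<le> (a + b) ^ n * (a / (a + b) * (X x / a) ^ n + b / (a + b) * (Y x / b) ^ n)"
      using assms by (intro mult_left_mono) auto
    moreover have "(a + b) ^ n * ((X x + Y x) / (a + b)) ^ n = (X x + Y x) ^ n"
      using assms by (simp add: power_divide)
    ultimately show ?thesis by simp
  qed
  then have "(\<Sum>x\<in>S. (X x + Y x) ^ n)
     \<le> (\<Sum>x\<in>S. (a + b) ^ n * (a / (a + b) * (X x / a) ^ n + b / (a + b) * (Y x / b) ^ n))"
    by (rule sum_mono)
  also have "\<dots> = (a + b) ^ n * (a / (a + b) * ((\<Sum>x\<in>S. X x ^ n) / a ^ n)
      + b / (a + b) * ((\<Sum>x\<in>S. Y x ^ n) / b ^ n))"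
    by (simp add: sum.distrib sum_distrib_left sum_divide_distrib power_divide ring_distribs)
  also have "\<dots> \<le> (a + b) ^ n * (a / (a + b) * c + b / (a + b) * c)"
    using assms by (intro mult_left_mono add_mono) (auto simp: divide_le_eq)
  also have "a / (a + b) * c + b / (a + b) * c = c"
    using assms by (simp add: add_divide_distrib[symmetric] distrib_right[symmetric])
  finally show ?thesis by (simp add: mult.commute)
qed

text \<open>The Walsh function of \<open>A\<close>; the set \<open>W\<close> encodes the sign vector
  that is -1 exactly on \<open>W\<close>.\<close>

definition walsh :: "'b set \<Rightarrow> 'b set \<Rightarrow> real" where
  "walsh A W = (\<Prod>x\<in>A. if x \<in> W then - 1 else 1)"

lemma sum_Pow_insert:
  assumes "finite I" "x \<notin> I"
  shows "(\<Sum>A\<in>Pow (insert x I). f A) = (\<Sum>A\<in>Pow I. f A) + (\<Sum>A\<in>Pow I. f (insert x A))"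
proof -
  have "inj_on (insert x) (Pow I)" using assms by (auto simp: inj_on_def)
  moreover have "Pow I \<inter> insert x ` Pow I = {}" using assms by auto
  ultimately show ?thesis using assms
    by (simp add: Pow_insert sum.union_disjoint sum.reindex)
qed

text \<open>
  Bonami's inequality. The bound \<open>s\<close> is strict so that in the induction it can be split
  into two positive parts even if one half of the coefficients vanishes.
\<close>
lemma walsh_hypercontractive:
  fixes b :: "'b set \<Rightarrow> complex"
  assumes "finite I"
    and "\<And>A. A \<subseteq> I \<Longrightarrow> K < card A \<Longrightarrow> b A = 0"
    and "(\<Sum>A\<in>Pow I. (norm (b A))\<^sup>2) < s"
  shows "(\<Sum>W\<in>Pow I. norm (\<Sum>A\<in>Pow I. b A * of_real (walsh A W)) ^ (2 * n))
    \<le> 2 ^ card I * ((4 * real n + 1) ^ K * s) ^ n"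
  using assms
proof (induction I arbitrary: b K s rule: finite_induct)
  case empty
  have s: "0 < s" using empty(2) by (simp add: order.strict_trans1[OF zero_le_power2])
  have "norm (b {}) ^ (2 * n) \<le> s ^ n"
    using empty(2) by (simp add: power_mult power_mono)
  also have "\<dots> \<le> ((4 * real n + 1) ^ K * s) ^ n"
  proof (rule power_mono)
    have "1 * s \<le> (4 * real n + 1) ^ K * s"
      using s by (intro mult_right_mono one_le_power) auto
    then show "s \<le> (4 * real n + 1) ^ K * s" by simp
  qed (use s in auto)
  finally show ?case by (simp add: walsh_def)
next
  case (insert x I)
  let ?c = "4 * real n + 1"
  define g where "g W = (\<Sum>A\<in>Pow I. b A * of_real (walsh A W))" for W
  define h where "h W = (\<Sum>A\<in>Pow I. b (insert x A) * of_real (walsh A W))" for W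
  define s1 where "s1 = (\<Sum>A\<in>Pow I. (norm (b (insert x A)))\<^sup>2) + (s - (\<Sum>A\<in>Pow (insert x I). (norm (b A))\<^sup>2)) / 2"
  define s0 where "s0 = s - s1"
  have s0: "(\<Sum>A\<in>Pow I. (norm (b A))\<^sup>2) < s0" and s1: "(\<Sum>A\<in>Pow I. (norm (b (insert x A)))\<^sup>2) < s1"
    using insert.prems(2) insert.hyps by (simp_all add: s0_def s1_def sum_Pow_insert field_simps)
  have pos: "0 < s0" "0 < s1"
    by (rule order.strict_trans1[OF _ s0], simp add: sum_nonneg,
        rule order.strict_trans1[OF _ s1], simp add: sum_nonneg)
  have w1: "walsh A (insert x W) = walsh A W" if "A \<subseteq> I" for A W
    unfolding walsh_def using that insert.hyps by (intro prod.cong) auto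
  have w2: "walsh (insert x A) W = (if x \<in> W then - 1 else 1) * walsh A W" if "A \<subseteq> I" for A W
    unfolding walsh_def using that insert.hyps by (subst prod.insert) (auto intro: finite_subset)
  have val: "(\<Sum>A\<in>Pow (insert x I). b A * of_real (walsh A W)) = g W + h W"
            "(\<Sum>A\<in>Pow (insert x I). b A * of_real (walsh A (insert x W))) = g W - h W"
    if "W \<subseteq> I" for W
    using that insert.hyps
    by (auto simp: sum_Pow_insert g_def h_def w1 w2 sum_negf[symmetric] simp del: sum_negf
        intro!: arg_cong2[where f = "(+)"] arg_cong2[where f = "(-)"] sum.cong)
  have g_le: "(\<Sum>W\<in>Pow I. norm (g W) ^ (2 * n)) \<le> 2 ^ card I * (?c ^ K * s0) ^ n"
    unfolding g_def using insert.prems(1) s0 by (intro insert.IH) auto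
  \<comment> \<open>Removing \<open>x\<close> from a set lowers the degree by one. The factor
    \<open>?c\<close> saved in this way pays for the factor \<open>?c\<close> that the two-point
    inequality puts on \<open>h\<close>.\<close>
  have h_le: "(\<Sum>W\<in>Pow I. (?c * (norm (h W))\<^sup>2) ^ n) \<le> 2 ^ card I * (?c ^ K * s1) ^ n"
  proof (cases K)
    case 0
    have "b (insert x A) = 0" if "A \<subseteq> I" for A
    proof (rule insert.prems(1))
      show "K < card (insert x A)" using 0 that insert.hyps finite_subset[OF that] by (auto simp: card_gt_0_iff)
    qed (use that in auto)
    then have "h W = 0" for W by (simp add: h_def)
    then show ?thesis using pos by (cases "n = 0") (auto simp: card_Pow insert.hyps)
  next
    case (Suc K')
    have "(\<Sum>W\<in>Pow I. norm (h W) ^ (2 * n)) \<le> 2 ^ card I * (?c ^ K' * s1) ^ n"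
      unfolding h_def
    proof (rule insert.IH)
      fix A assume A: "A \<subseteq> I" "K' < card A"
      then show "b (insert x A) = 0"
        using insert.hyps finite_subset[OF A(1)] Suc by (intro insert.prems(1)) (auto simp: card_insert_if)
    qed (rule s1)
    then have "?c ^ n * (\<Sum>W\<in>Pow I. norm (h W) ^ (2 * n)) \<le> ?c ^ n * (2 ^ card I * (?c ^ K' * s1) ^ n)"
      by (intro mult_left_mono) auto
    moreover have "(?c * (norm (h W))\<^sup>2) ^ n = ?c ^ n * norm (h W) ^ (2 * n)" for W
      by (simp add: power_mult_distrib power_mult)
    moreover have "?c ^ n * (2 ^ card I * (?c ^ K' * s1) ^ n) = 2 ^ card I * (?c ^ K * s1) ^ n"
      by (simp add: Suc power_mult_distrib mult_ac)
    ultimately show ?thesis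
      by (simp add: sum_distrib_left)
  qed
  have "(\<Sum>W\<in>Pow (insert x I). norm (\<Sum>A\<in>Pow (insert x I). b A * of_real (walsh A W)) ^ (2 * n))
     = (\<Sum>W\<in>Pow I. norm (g W + h W) ^ (2 * n) + norm (g W - h W) ^ (2 * n))"
    unfolding sum_Pow_insert[OF insert.hyps, where f = "\<lambda>W. norm (_ W) ^ (2 * n)"] sum.distrib
    by (intro arg_cong2[where f = "(+)"] sum.cong) (simp_all add: val)
  also have "\<dots> \<le> (\<Sum>W\<in>Pow I. 2 * ((norm (g W))\<^sup>2 + ?c * (norm (h W))\<^sup>2) ^ n)"
  proof (rule sum_mono)
    fix W
    show "norm (g W + h W) ^ (2 * n) + norm (g W - h W) ^ (2 * n) \<le> 2 * ((norm (g W))\<^sup>2 + ?c * (norm (h W))\<^sup>2) ^ n"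
      using two_point_complex[of "g W" "h W" n] by simp
  qed
  also have "\<dots> = 2 * (\<Sum>W\<in>Pow I. ((norm (g W))\<^sup>2 + ?c * (norm (h W))\<^sup>2) ^ n)"
    by (simp add: sum_distrib_left)
  also have "\<dots> \<le> 2 * (2 ^ card I * (?c ^ K * s0 + ?c ^ K * s1) ^ n)"
    using g_le h_le pos by (intro mult_left_mono sum_power_add_le) (auto simp: power_mult)
  also have "?c ^ K * s0 + ?c ^ K * s1 = ?c ^ K * s"
    by (simp add: s0_def algebra_simps)
  finally show ?case using insert.hyps by simp
qed

section \<open>Riesz products and moments\<close>

text \<open>The tangent of the p-th power at m lies below the graph: Bernoulli's inequality rescaled
  by m. Integrating it yields Jensen's inequality below.\<close>

lemma power_ge_tangent:
  fixes t m :: real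
  assumes "0 \<le> t" "0 \<le> m"
  shows "m ^ p + real p * m ^ (p - 1) * (t - m) \<le> t ^ p"
proof (cases "m = 0 \<or> p = 0")
  case True
  then consider "p = 0" | "p = 1" | "m = 0" "2 \<le> p" by force
  then show ?thesis using assms by cases (auto simp: power_0_left)
next
  case False
  then have m: "0 < m" and p: "p = Suc (p - 1)" using assms by auto
  have "1 + real p * (t / m - 1) \<le> (1 + (t / m - 1)) ^ p"
    using assms by (intro Bernoulli_inequality) auto
  then have "m ^ p * (1 + real p * (t / m - 1)) \<le> m ^ p * (t / m) ^ p"
    using m by (intro mult_left_mono) auto
  also have "\<dots> = t ^ p"
    using m by (simp add: power_divide)
  also have "m ^ p * (1 + real p * (t / m - 1)) = m ^ p + real p * m ^ (p - 1) * (t - m)"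
    using m by (subst (1 2) p) (simp add: field_simps)
  finally show ?thesis .
qed

section \<open>Convolution of trigonometric polynomials with positive kernels\<close>

lemma integrable_mult_cnj_torus_char:
  assumes "integrable torus G"
  shows "integrable torus (\<lambda>\<theta>. G \<theta> * cnj (torus_char m \<theta>))"
proof (rule Bochner_Integration.integrable_bound[OF assms])
  have [measurable]: "G \<in> borel_measurable torus" using assms by (rule borel_measurable_integrable)
  show "(\<lambda>\<theta>. G \<theta> * cnj (torus_char m \<theta>)) \<in> borel_measurable torus"
    unfolding torus_char_minus[symmetric] by measurable
qed (simp add: norm_mult)

lemma norm_torus_poly_le:
  "norm (\<Sum>t\<in>T. b t * torus_char (v t) \<theta>) \<le> (\<Sum>t\<in>T. norm (b t))"
  by (rule order.trans[OF norm_sum]) (simp add: norm_mult)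

lemma integrable_torus_poly_power:
  "integrable torus (\<lambda>\<theta>. norm (\<Sum>t\<in>T. b t * torus_char (v t) \<theta>) ^ p)"
proof (rule torus.integrable_const_bound)
  show "AE \<theta> in torus. norm (norm (\<Sum>t\<in>T. b t * torus_char (v t) \<theta>) ^ p) \<le> (\<Sum>t\<in>T. norm (b t)) ^ p"
    by (auto intro!: power_mono norm_torus_poly_le)
qed measurable

lemma integrable_torus_poly: "integrable torus (\<lambda>\<theta>. \<Sum>t\<in>T. b t * torus_char (v t) \<theta>)"
  by simp

text \<open>Jensen's inequality for the probability density \<open>w\<close>: integrate the tangent
  of the p-th power at the point m = |integral of F w|. The linear term is nonnegative because m is
  at most the integral of |F| w.\<close>

lemma norm_integral_power_le:
  fixes F :: "'a \<Rightarrow> complex" and w :: "'a \<Rightarrow> real"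
  assumes "integrable M w" "\<And>x. 0 \<le> w x" "(LINT x|M. w x) = 1"
    and "integrable M (\<lambda>x. F x * of_real (w x))" "integrable M (\<lambda>x. norm (F x) ^ p * w x)"
  shows "norm (LINT x|M. F x * of_real (w x)) ^ p \<le> (LINT x|M. norm (F x) ^ p * w x)"
proof -
  define m where "m = norm (LINT x|M. F x * of_real (w x))"
  have int1: "integrable M (\<lambda>x. norm (F x) * w x)"
    using integrable_norm[OF assms(4)] assms(2) by (simp add: norm_mult)
  have m_le: "m \<le> (LINT x|M. norm (F x) * w x)"
    unfolding m_def using integral_norm_bound[of M "\<lambda>x. F x * of_real (w x)"] assms(2) by (simp add: norm_mult)
  have eq: "(m ^ p + real p * m ^ (p - 1) * (norm (F x) - m)) * w x =
      (m ^ p - real p * m ^ (p - 1) * m) * w x + real p * m ^ (p - 1) * (norm (F x) * w x)" for x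
    by (simp add: algebra_simps)
  have lin: "(LINT x|M. \<alpha> * w x + \<beta> * (norm (F x) * w x)) = \<alpha> + \<beta> * (LINT x|M. norm (F x) * w x)" for \<alpha> \<beta>
    using assms(1,3) int1 by simp
  have "m ^ p \<le> m ^ p + real p * m ^ (p - 1) * ((LINT x|M. norm (F x) * w x) - m)"
    using m_le by (simp add: m_def)
  also have "\<dots> = (LINT x|M. (m ^ p + real p * m ^ (p - 1) * (norm (F x) - m)) * w x)"
    unfolding eq lin by (simp add: algebra_simps)
  also have "\<dots> \<le> (LINT x|M. norm (F x) ^ p * w x)"
  proof (rule integral_mono)
    show "integrable M (\<lambda>x. (m ^ p + real p * m ^ (p - 1) * (norm (F x) - m)) * w x)"
      unfolding eq using assms(1) int1 by simp
    show "(m ^ p + real p * m ^ (p - 1) * (norm (F x) - m)) * w x \<le> norm (F x) ^ p * w x" for x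
      using assms(2) by (intro mult_right_mono power_ge_tangent) (auto simp: m_def)
  qed (rule assms(5))
  finally show ?thesis by (simp add: m_def)
qed

text \<open>Convolution with a positive kernel of mass one contracts every p-th moment. The kernel
  is a trigonometric polynomial, so the convolution is expanded in characters, and neither Fubini
  nor translation invariance of the torus is invoked. The arguments of \<open>R\<close> are
  differences that may leave the cube, hence the hypotheses on \<open>R\<close> for all
  \<open>y\<close>. Since \<open>u\<close> need not be injective, a Fourier coefficient of the
  kernel is a sum over a fibre of \<open>u\<close>.\<close>

lemma positive_kernel_power_le:
  fixes u :: "'x \<Rightarrow> int ^ 'n" and v :: "'t \<Rightarrow> int ^ 'n" and R :: "real ^ 'n \<Rightarrow> real"
  assumes fin: "finite X"
    and R: "\<And>y. (\<Sum>x\<in>X. c x * torus_char (u x) y) = of_real (R y)" and R_nonneg: "\<And>y. 0 \<le> R y"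
    and hat_0: "(\<Sum>x\<in>{x \<in> X. u x = 0}. c x) = 1"
    and hat: "\<And>t. t \<in> T \<Longrightarrow> a t = b t * (\<Sum>x\<in>{x \<in> X. u x = v t}. c x)"
  shows "(LINT \<theta>|torus. norm (\<Sum>t\<in>T. a t * torus_char (v t) \<theta>) ^ p)
    \<le> (LINT \<theta>|torus. norm (\<Sum>t\<in>T. b t * torus_char (v t) \<theta>) ^ p)"
proof -
  define F where "F \<theta> = (\<Sum>t\<in>T. b t * torus_char (v t) \<theta>)" for \<theta>
  define P where "P \<theta> = (\<Sum>t\<in>T. a t * torus_char (v t) \<theta>)" for \<theta>
  have expand: "G \<psi> * of_real (R (\<theta> - \<psi>)) =
      (\<Sum>x\<in>X. c x * torus_char (u x) \<theta> * (G \<psi> * cnj (torus_char (u x) \<psi>)))" for G :: "real ^ 'n \<Rightarrow> complex" and \<theta> \<psi>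
    by (simp add: R[symmetric] torus_char_diff_right sum_distrib_left mult_ac)
  have conv_int: "integrable torus (\<lambda>\<psi>. G \<psi> * of_real (R (\<theta> - \<psi>)))" if "integrable torus G" for G :: "real ^ 'n \<Rightarrow> complex" and \<theta>
    unfolding expand using that
    by (intro Bochner_Integration.integrable_sum integrable_mult_right integrable_mult_cnj_torus_char)
  have conv: "(LINT \<psi>|torus. G \<psi> * of_real (R (\<theta> - \<psi>))) =
      (\<Sum>x\<in>X. c x * torus_char (u x) \<theta> * (LINT \<psi>|torus. G \<psi> * cnj (torus_char (u x) \<psi>)))"
    if "integrable torus G" for G :: "real ^ 'n \<Rightarrow> complex" and \<theta>
    unfolding expand using that
    by (subst Bochner_Integration.integral_sum)
      (auto intro!: integrable_mult_right integrable_mult_cnj_torus_char)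
  have orth: "(LINT \<psi>|torus. torus_char l \<psi> * cnj (torus_char m \<psi>)) = of_bool (m = l)" for l m :: "int ^ 'n"
  proof -
    have "(LINT \<psi>|torus. torus_char l \<psi> * cnj (torus_char m \<psi>)) = (LINT \<psi>|torus. torus_char (l + - m) \<psi>)"
      unfolding torus_char_add torus_char_minus ..
    then show ?thesis by (auto simp: integral_torus_char)
  qed
  have of_bool_sum: "(\<Sum>x\<in>X. h x * of_bool (u x = l)) = (\<Sum>x\<in>{x \<in> X. u x = l}. h x)" for l and h :: "_ \<Rightarrow> complex"
    using fin by (simp add: of_bool_def if_distrib sum.inter_filter cong: if_cong)
  have char_conv: "(LINT \<psi>|torus. torus_char l \<psi> * of_real (R (\<theta> - \<psi>))) =
      (\<Sum>x\<in>{x \<in> X. u x = l}. c x) * torus_char l \<theta>" for l \<theta>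
    by (subst conv) (auto simp: orth of_bool_sum sum_distrib_right)
  have F_int: "integrable torus F"
    unfolding F_def by (rule integrable_torus_poly)
  have Fp_int: "integrable torus (\<lambda>\<psi>. complex_of_real (norm (F \<psi>) ^ p))"
    using integrable_torus_poly_power[where T = T and b = b and v = v and p = p] unfolding F_def by (rule integrable_of_real)
  have F_conv: "(LINT \<psi>|torus. F \<psi> * of_real (R (\<theta> - \<psi>))) = P \<theta>" for \<theta>
  proof -
    have "(LINT \<psi>|torus. F \<psi> * of_real (R (\<theta> - \<psi>))) =
        (\<Sum>t\<in>T. b t * (LINT \<psi>|torus. torus_char (v t) \<psi> * of_real (R (\<theta> - \<psi>))))"
      unfolding F_def sum_distrib_right mult.assoc
      by (subst Bochner_Integration.integral_sum) (auto intro!: integrable_mult_right conv_int)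
    also have "\<dots> = P \<theta>"
      unfolding P_def by (intro sum.cong refl) (simp add: char_conv hat mult_ac)
    finally show ?thesis .
  qed
  have R_int: "integrable torus (\<lambda>\<psi>. R (\<theta> - \<psi>))" for \<theta>
    using integrable_Re[OF conv_int[of "torus_char 0" \<theta>]] by simp
  have R_1: "(LINT \<psi>|torus. R (\<theta> - \<psi>)) = 1" for \<theta>
    using char_conv[of 0 \<theta>] hat_0 by (simp add: of_real_eq_1_iff)
  have Fw_int: "integrable torus (\<lambda>\<psi>. norm (F \<psi>) ^ p * R (\<theta> - \<psi>))" for \<theta>
    using integrable_Re[OF conv_int[OF Fp_int, of \<theta>]] by simp
  \<comment> \<open>\<open>H\<close> dominates the p-th power of \<open>P\<close> pointwise by
    Jensen. It is again a trigonometric polynomial, so its integral is its constant coefficient, and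
    the mass-one condition identifies this with the p-th moment of \<open>F\<close>.\<close>
  define H where "H \<theta> = (LINT \<psi>|torus. norm (F \<psi>) ^ p * R (\<theta> - \<psi>))" for \<theta>
  have H: "complex_of_real (H \<theta>) =
     (\<Sum>x\<in>X. (c x * (LINT \<psi>|torus. of_real (norm (F \<psi>) ^ p) * cnj (torus_char (u x) \<psi>))) * torus_char (u x) \<theta>)" for \<theta>
  proof -
    have "complex_of_real (H \<theta>) = (LINT \<psi>|torus. complex_of_real (norm (F \<psi>) ^ p) * of_real (R (\<theta> - \<psi>)))"
      unfolding H_def of_real_mult[symmetric] by (rule integral_complex_of_real[symmetric])
    then show ?thesis unfolding conv[OF Fp_int, of \<theta>] by (simp add: mult_ac)
  qed
  have H_int: "integrable torus H"
  proof -
    have eq: "H = (\<lambda>\<theta>. Re (\<Sum>x\<in>X. (c x * (LINT \<psi>|torus. of_real (norm (F \<psi>) ^ p) * cnj (torus_char (u x) \<psi>))) * torus_char (u x) \<theta>))"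
      unfolding H[symmetric] by simp
    show ?thesis by (subst eq) (intro integrable_Re integrable_torus_poly)
  qed
  have "complex_of_real (LINT \<theta>|torus. H \<theta>) = (LINT \<theta>|torus. complex_of_real (H \<theta>))"
    by simp
  also have "\<dots> = (\<Sum>x\<in>X. (c x * (LINT \<psi>|torus. of_real (norm (F \<psi>) ^ p) * cnj (torus_char (u x) \<psi>))) * of_bool (u x = 0))"
    unfolding H by (subst Bochner_Integration.integral_sum) (auto simp: integral_torus_char)
  also have "\<dots> = (\<Sum>x\<in>{x \<in> X. u x = 0}. c x) * (LINT \<psi>|torus. of_real (norm (F \<psi>) ^ p))"
    unfolding of_bool_sum sum_distrib_right by (intro sum.cong) auto
  also have "\<dots> = of_real (LINT \<psi>|torus. norm (F \<psi>) ^ p)"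
    unfolding hat_0 by (simp only: integral_complex_of_real mult_1)
  finally have H_eq: "(LINT \<theta>|torus. H \<theta>) = (LINT \<psi>|torus. norm (F \<psi>) ^ p)"
    by (simp only: of_real_eq_iff)
  have "(LINT \<theta>|torus. norm (P \<theta>) ^ p) \<le> (LINT \<theta>|torus. H \<theta>)"
  proof (rule integral_mono[OF _ H_int])
    show "integrable torus (\<lambda>\<theta>. norm (P \<theta>) ^ p)"
      unfolding P_def by (rule integrable_torus_poly_power)
    show "norm (P \<theta>) ^ p \<le> H \<theta>" for \<theta>
      unfolding H_def F_conv[symmetric]
      by (rule norm_integral_power_le[OF R_int R_nonneg R_1 conv_int[OF F_int] Fw_int])
  qed
  then show ?thesis unfolding H_eq by (simp add: P_def F_def)
qed

text \<open>The left-hand sums are the frequencies of a Riesz product, the right-hand sums those of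
  the polynomials to be tested. Signs of frequencies are absorbed into \<open>v\<close>, so only
  subset sums need a unique representation.\<close>

definition dissociated :: "'b set \<Rightarrow> ('b \<Rightarrow> int ^ 'n) \<Rightarrow> bool" where
  "dissociated I v \<longleftrightarrow> (\<forall>A \<epsilon>. A \<subseteq> I \<longrightarrow> \<epsilon> \<in> I \<rightarrow>\<^sub>E {-1, 0, 1} \<longrightarrow>
     (\<Sum>b\<in>I. \<epsilon> b *s v b) = (\<Sum>b\<in>A. v b) \<longrightarrow> (\<forall>b\<in>I. \<epsilon> b = of_bool (b \<in> A)))"

lemma torus_char_riesz_factor:
  "(\<Sum>e\<in>{-1, 0, 1::int}. (if e = 0 then 1 else of_real (w / 2)) * torus_char (e *s l) y)
    = of_real (1 + w * Re (torus_char l y))"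
proof -
  have "(-1) *s l = - l" "1 *s l = l" "0 *s l = 0" by (simp_all add: vec_eq_iff)
  then have "(\<Sum>e\<in>{-1, 0, 1::int}. (if e = 0 then 1 else of_real (w / 2)) * torus_char (e *s l) y)
     = 1 + of_real (w / 2) * (torus_char l y + cnj (torus_char l y))"
    by (simp add: torus_char_minus algebra_simps)
  then show ?thesis by (simp add: complex_add_cnj)
qed

text \<open>For each sign vector \<open>W\<close> the Riesz product multiplies the coefficient at
  the subset sum of \<open>A\<close> by \<open>walsh A W\<close> / 2^|A|. Starting from
  \<open>F W\<close>, with coefficients 2^|A| a_A \<open>walsh A W\<close>, convolution therefore
  returns \<open>P\<close> itself, and the moment of \<open>P\<close> is at most that of
  \<open>F W\<close>. This holds for every \<open>W\<close>, so one may average over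
  \<open>W\<close> and apply Bonami's inequality pointwise in the torus variable.\<close>

lemma moment_le_dissociated:
  fixes a :: "'b set \<Rightarrow> complex" and v :: "'b \<Rightarrow> int ^ 'n"
  assumes fin: "finite I" and dis: "dissociated I v"
    and deg: "\<And>A. A \<subseteq> I \<Longrightarrow> K < card A \<Longrightarrow> a A = 0"
    and l2: "(\<Sum>A\<in>Pow I. (norm (a A))\<^sup>2) \<le> 1"
  shows "(LINT \<theta>|torus. norm (\<Sum>A\<in>Pow I. a A * torus_char (\<Sum>b\<in>A. v b) \<theta>) ^ (2 * i))
    \<le> ((4 * real i + 1) ^ K * (2 * 4 ^ K)) ^ i"
proof -
  let ?D = "{-1, 0, 1} :: int set"
  define \<omega> where "\<omega> W b = (if b \<in> W then - 1 else 1 :: real)" for W and b :: 'b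
  define c where "c W \<epsilon> = (\<Prod>b\<in>I. if \<epsilon> b = 0 then 1 else complex_of_real (\<omega> W b / 2))"
    for W and \<epsilon> :: "'b \<Rightarrow> int"
  define u where "u \<epsilon> = (\<Sum>b\<in>I. \<epsilon> b *s v b)" for \<epsilon>
  define R where "R W y = (\<Prod>b\<in>I. 1 + \<omega> W b * Re (torus_char (v b) y))" for W y
  define V where "V A = (\<Sum>b\<in>A. v b)" for A
  have finP: "finite (I \<rightarrow>\<^sub>E ?D)" using fin by (intro finite_PiE) auto
  have finA: "finite A" if "A \<subseteq> I" for A using fin that finite_subset by blast
  have R: "(\<Sum>\<epsilon>\<in>I \<rightarrow>\<^sub>E ?D. c W \<epsilon> * torus_char (u \<epsilon>) y) = of_real (R W y)" for W y
    unfolding R_def of_real_prod torus_char_riesz_factor[symmetric] c_def u_def torus_char_sum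
      prod.distrib[symmetric]
    using fin by (intro prod_sum_PiE[symmetric]) auto
  have R_nonneg: "0 \<le> R W y" for W y
    unfolding R_def
  proof (rule prod_nonneg)
    fix b
    have "\<bar>Re (torus_char (v b) y)\<bar> \<le> 1"
      by (metis abs_Re_le_cmod norm_torus_char)
    then show "0 \<le> 1 + \<omega> W b * Re (torus_char (v b) y)" by (auto simp: \<omega>_def)
  qed
  \<comment> \<open>Dissociation leaves a single term in the sum, that of the indicator of
    \<open>A\<close>.\<close>
  have hat: "(\<Sum>\<epsilon>\<in>{\<epsilon> \<in> I \<rightarrow>\<^sub>E ?D. u \<epsilon> = V A}. c W \<epsilon>) = of_real (walsh A W) / 2 ^ card A"
    if A: "A \<subseteq> I" for A W
  proof -
    let ?e = "restrict (\<lambda>b. of_bool (b \<in> A)) I :: 'b \<Rightarrow> int"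
    have "u ?e = (\<Sum>b\<in>I. if b \<in> A then v b else 0)"
      unfolding u_def by (intro sum.cong) (auto simp: vec_eq_iff)
    also have "\<dots> = V A"
      unfolding V_def using A fin by (simp add: sum.inter_restrict[symmetric] Int_absorb1)
    finally have ue: "u ?e = V A" .
    have "{\<epsilon> \<in> I \<rightarrow>\<^sub>E ?D. u \<epsilon> = V A} = {?e}"
    proof (intro set_eqI iffI)
      fix \<epsilon> assume \<epsilon>: "\<epsilon> \<in> {\<epsilon> \<in> I \<rightarrow>\<^sub>E ?D. u \<epsilon> = V A}"
      then have "\<forall>b\<in>I. \<epsilon> b = of_bool (b \<in> A)"
        using dis A unfolding dissociated_def u_def V_def by blast
      then have "\<epsilon> = ?e"
        using \<epsilon> by (intro ext) (auto simp: PiE_def extensional_def)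
      then show "\<epsilon> \<in> {?e}" by simp
    qed (use ue in \<open>auto simp: PiE_def\<close>)
    then have "(\<Sum>\<epsilon>\<in>{\<epsilon> \<in> I \<rightarrow>\<^sub>E ?D. u \<epsilon> = V A}. c W \<epsilon>) = c W ?e"
      by simp
    also have "\<dots> = (\<Prod>b\<in>I. if b \<in> A then of_real (\<omega> W b / 2) else 1)"
      unfolding c_def by (intro prod.cong) auto
    also have "\<dots> = (\<Prod>b\<in>A. of_real (\<omega> W b / 2))"
      using A fin by (simp add: prod.inter_restrict[symmetric] Int_absorb1)
    also have "\<dots> = of_real (walsh A W) / 2 ^ card A"
      by (simp add: walsh_def \<omega>_def prod_dividef)
    finally show ?thesis .
  qed
  have walsh_sq: "walsh A W * walsh A W = 1" for A and W :: "'b set"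
    unfolding walsh_def prod.distrib[symmetric] by (intro prod.neutral) auto
  define F where "F W \<theta> = (\<Sum>A\<in>Pow I. (2 ^ card A * a A * of_real (walsh A W)) * torus_char (V A) \<theta>)" for W \<theta>
  define P where "P \<theta> = (\<Sum>A\<in>Pow I. a A * torus_char (V A) \<theta>)" for \<theta>
  have PF: "(LINT \<theta>|torus. norm (P \<theta>) ^ (2 * i)) \<le> (LINT \<theta>|torus. norm (F W \<theta>) ^ (2 * i))" for W
    unfolding P_def F_def
  proof (rule positive_kernel_power_le[where R = "R W"])
    show "(\<Sum>x\<in>{x \<in> I \<rightarrow>\<^sub>E ?D. u x = 0}. c W x) = 1"
      using hat[of "{}" W] by (simp add: V_def walsh_def)
    fix A assume "A \<in> Pow I"
    then show "a A = 2 ^ card A * a A * of_real (walsh A W) * (\<Sum>x\<in>{x \<in> I \<rightarrow>\<^sub>E ?D. u x = V A}. c W x)"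
      using walsh_sq[of A W] by (simp add: hat flip: of_real_mult)
  qed (use finP R R_nonneg in auto)
  have Fint: "integrable torus (\<lambda>\<theta>. norm (F W \<theta>) ^ (2 * i))" for W
    unfolding F_def by (rule integrable_torus_poly_power)
  \<comment> \<open>The squared factors 2^|A| cost at most 4^K; the additional 2 only provides the
    strict inequality that the Walsh bound asks for.\<close>
  let ?B = "2 ^ card I * ((4 * real i + 1) ^ K * (2 * 4 ^ K)) ^ i"
  have "2 ^ card I * (LINT \<theta>|torus. norm (P \<theta>) ^ (2 * i)) = (\<Sum>W\<in>Pow I. (LINT \<theta>|torus. norm (P \<theta>) ^ (2 * i)))"
    using fin by (simp add: card_Pow)
  also have "\<dots> \<le> (\<Sum>W\<in>Pow I. (LINT \<theta>|torus. norm (F W \<theta>) ^ (2 * i)))"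
    by (intro sum_mono PF)
  also have "\<dots> = (LINT \<theta>|torus. (\<Sum>W\<in>Pow I. norm (F W \<theta>) ^ (2 * i)))"
    by (rule Bochner_Integration.integral_sum[symmetric]) (rule Fint)
  also have "\<dots> \<le> (LINT \<theta>|(torus :: (real^'n) measure). ?B)"
  proof (rule integral_mono)
    fix \<theta> :: "real ^ 'n"
    have deg': "2 ^ card A * a A * torus_char (V A) \<theta> = 0" if "A \<subseteq> I" "K < card A" for A
      using deg that by simp
    have "(\<Sum>A\<in>Pow I. (norm (2 ^ card A * a A * torus_char (V A) \<theta>))\<^sup>2) \<le> (\<Sum>A\<in>Pow I. 4 ^ K * (norm (a A))\<^sup>2)"
    proof (rule sum_mono)
      fix A assume A: "A \<in> Pow I"
      show "(norm (2 ^ card A * a A * torus_char (V A) \<theta>))\<^sup>2 \<le> 4 ^ K * (norm (a A))\<^sup>2"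
      proof (cases "K < card A")
        case True with A deg show ?thesis by simp
      next
        case False
        have "(norm (2 ^ card A * a A * torus_char (V A) \<theta>))\<^sup>2 = 4 ^ card A * (norm (a A))\<^sup>2"
          by (simp add: norm_mult norm_power power_mult_distrib flip: power_mult)
             (simp add: power_mult mult.commute[of _ 2])
        also have "\<dots> \<le> 4 ^ K * (norm (a A))\<^sup>2"
          using False by (intro mult_right_mono power_increasing) auto
        finally show ?thesis .
      qed
    qed
    also have "\<dots> \<le> 4 ^ K * 1"
      unfolding sum_distrib_left[symmetric] using l2 by (intro mult_left_mono) auto
    also have "\<dots> < (2 * 4 ^ K :: real)" by simp
    finally have l2': "(\<Sum>A\<in>Pow I. (norm (2 ^ card A * a A * torus_char (V A) \<theta>))\<^sup>2) < 2 * 4 ^ K" .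
    have F_eq: "F W \<theta> = (\<Sum>A\<in>Pow I. (2 ^ card A * a A * torus_char (V A) \<theta>) * of_real (walsh A W))" for W
      unfolding F_def by (intro sum.cong) auto
    show "(\<Sum>W\<in>Pow I. norm (F W \<theta>) ^ (2 * i)) \<le> ?B"
      unfolding F_eq by (rule walsh_hypercontractive[OF fin deg' l2'])
  qed (auto intro: Fint)
  also have "\<dots> = ?B" by simp
  finally show ?thesis
    by (simp add: P_def V_def)
qed

section \<open>Duality with LlogL\<close>

text \<open>Chosen so that the moment series in the duality argument is dominated by the powers of
  1/2. The exponential comes from the base in \<open>young_LlogL\<close>, and 20^K from (4i+1)^K 4^K
  being at most 20^K i^K for i at least 1.\<close>

definition young_const :: "nat \<Rightarrow> real" where
  "young_const K = 2 * sqrt (exp (1 + real K) * 20 ^ K)"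

lemma young_const_pos: "0 < young_const K"
  by (simp add: young_const_def)

lemma young_const_power2: "(young_const K)\<^sup>2 = 4 * exp (1 + real K) * 20 ^ K"
  by (simp add: young_const_def power_mult_distrib)

text \<open>
  With \<open>u = (t / a) powr (2 / K)\<close> either \<open>u \<le> ln (1 + s)\<close>, and the first summand dominates, or
  \<open>s \<le> exp u\<close>, and the term \<open>i = \<lfloor>u\<rfloor>\<close> of the sum dominates. Only even powers of \<open>t\<close>
  occur; for \<open>i = 0\<close> the base is a division by zero but the power is \<open>1\<close>.
\<close>
lemma young_LlogL:
  fixes s t T a :: real
  assumes s: "0 \<le> s" and t: "0 \<le> t" "t \<le> T" and a: "0 < a" and K: "1 \<le> K"
  shows "s * t \<le> a * (s * ln (1 + s) powr (real K / 2)) +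
    a * exp 1 * (\<Sum>i\<le>nat \<lfloor>(T / a) powr (2 / real K)\<rfloor>. (exp (1 + real K) / (a\<^sup>2 * real i ^ K) * t\<^sup>2) ^ i)"
proof (cases "t \<le> a * ln (1 + s) powr (real K / 2)")
  case True
  then have "s * t \<le> s * (a * ln (1 + s) powr (real K / 2))"
    using s by (rule mult_left_mono)
  moreover have "0 \<le> a * exp 1 * (\<Sum>i\<le>nat \<lfloor>(T / a) powr (2 / real K)\<rfloor>. (exp (1 + real K) / (a\<^sup>2 * real i ^ K) * t\<^sup>2) ^ i)"
    using a t by (intro mult_nonneg_nonneg sum_nonneg zero_le_power) auto
  ultimately show ?thesis by (simp add: mult_ac)
next
  case False
  define u where "u = (t / a) powr (2 / real K)"
  define i where "i = nat \<lfloor>u\<rfloor>"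
  let ?term = "(exp (1 + real K) / (a\<^sup>2 * real i ^ K) * t\<^sup>2) ^ i"
  have t_pos: "0 < t"
    using False a by (smt (verit) mult_nonneg_nonneg powr_ge_zero)
  have u_powr: "u powr (real K / 2) = t / a"
    using K a t_pos by (simp add: u_def powr_powr)
  have u_nonneg: "0 \<le> u" by (simp add: u_def)
  have "ln (1 + s) < u"
  proof (rule ccontr)
    assume "\<not> ln (1 + s) < u"
    then have "u powr (real K / 2) \<le> ln (1 + s) powr (real K / 2)"
      using u_nonneg by (intro powr_mono2) auto
    then show False using False a by (simp add: u_powr divide_le_eq mult.commute)
  qed
  then have "1 + s < exp u"
    using s by (metis add_pos_nonneg exp_less_mono exp_ln zero_less_one)
  moreover have iu: "real i \<le> u" "u < real i + 1"
    using u_nonneg by (simp_all add: i_def)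
  ultimately have s_le: "s \<le> exp (real i + 1)"
    using exp_less_mono[OF iu(2)] by linarith
  have i_le: "i \<le> nat \<lfloor>(T / a) powr (2 / real K)\<rfloor>"
    unfolding i_def u_def using t a by (intro nat_mono floor_mono powr_mono2 divide_right_mono) auto
  have "s * t \<le> a * exp 1 * ?term"
  proof (cases "i = 0")
    case True
    then have "u powr (real K / 2) \<le> 1 powr (real K / 2)"
      using iu u_nonneg by (intro powr_mono2) auto
    then have "t \<le> a" using a by (simp add: u_powr)
    then have "s * t \<le> exp 1 * a"
      using s_le t True by (intro mult_mono) auto
    then show ?thesis using True by (simp add: mult.commute)
  next
    case False
    \<comment> \<open>With \<open>q\<close> at least 1, t/a is at most its square, which is q i^K,
      and this is at most q^i e^(iK). Together with s being at most e^(i+1) this is where the base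
      factor \<open>exp (1 + real K)\<close> and the outer \<open>exp 1\<close> come from.\<close>
    define q where "q = (t / a)\<^sup>2 / real i ^ K"
    have i1: "1 \<le> real i" using False by simp
    have iK: "1 \<le> real i ^ K" using i1 by (rule one_le_power)
    have "real i powr (real K / 2) \<le> t / a"
      unfolding u_powr[symmetric] using iu i1 by (intro powr_mono2) auto
    then have "(real i powr (real K / 2))\<^sup>2 \<le> (t / a)\<^sup>2"
      by (intro power_mono) auto
    moreover have "(real i powr (real K / 2))\<^sup>2 = real i ^ K"
      using i1 by (simp add: powr_power powr_realpow)
    ultimately have q1: "1 \<le> q" using i1 iK by (simp add: q_def le_divide_eq)
    have ta: "(t / a)\<^sup>2 = q * real i ^ K" using i1 iK by (simp add: q_def)
    have "1 * 1 \<le> q * real i ^ K" using q1 iK by (intro mult_mono) auto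
    then have "1\<^sup>2 \<le> (t / a)\<^sup>2" unfolding ta by simp
    then have "1 \<le> t / a" by (rule power2_le_imp_le) (use t a in simp)
    then have "t / a \<le> (t / a)\<^sup>2" by (simp add: self_le_power)
    also have "\<dots> \<le> q ^ i * exp (real i * real K)"
      unfolding ta
    proof (rule mult_mono)
      show "q \<le> q ^ i" using q1 False by (intro self_le_power) auto
      have "real i \<le> exp (real i)" using exp_ge_add_one_self[of "real i"] by linarith
      then have "real i ^ K \<le> exp (real i) ^ K" by (intro power_mono) auto
      then show "real i ^ K \<le> exp (real i * real K)" by (simp add: exp_of_nat_mult[symmetric] mult.commute)
    qed (use q1 in auto)
    finally have "t \<le> a * (q ^ i * exp (real i * real K))"
      using a by (simp add: divide_le_eq mult.commute)
    then have "s * t \<le> exp (real i + 1) * (a * (q ^ i * exp (real i * real K)))"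
      using s_le t by (intro mult_mono) auto
    also have "\<dots> = a * exp 1 * (exp (real i + real i * real K) * q ^ i)"
      by (simp add: exp_add)
    also have "exp (real i + real i * real K) * q ^ i = (exp (1 + real K) * q) ^ i"
      by (simp add: power_mult_distrib exp_of_nat_mult[symmetric] ring_distribs)
    also have "exp (1 + real K) * q = exp (1 + real K) / (a\<^sup>2 * real i ^ K) * t\<^sup>2"
      by (simp add: q_def power_divide)
    finally show ?thesis .
  qed
  also have "\<dots> \<le> a * exp 1 * (\<Sum>i\<le>nat \<lfloor>(T / a) powr (2 / real K)\<rfloor>. (exp (1 + real K) / (a\<^sup>2 * real i ^ K) * t\<^sup>2) ^ i)"
    using a i_le by (intro mult_left_mono member_le_sum) auto
  also have "\<dots> \<le> a * (s * ln (1 + s) powr (real K / 2)) + \<dots>"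
    using a s by simp
  finally show ?thesis .
qed

text \<open>The smaller exponent can give the larger value only where \<open>ln (1 + s)\<close> is
  below 1, that is, for s < e - 1; there the left-hand side is at most s.\<close>

lemma ln_powr_mono:
  fixes s r r' :: real
  assumes "0 \<le> s" "0 \<le> r" "r \<le> r'"
  shows "s * ln (1 + s) powr r \<le> s * ln (1 + s) powr r' + exp 1"
proof (cases "1 + s \<le> exp 1")
  case True
  then have "ln (1 + s) \<le> 1" using assms by (metis add_pos_nonneg ln_exp ln_le_cancel_iff exp_gt_zero zero_less_one)
  then have "ln (1 + s) powr r \<le> 1"
    using assms powr_le1 by simp
  then have "s * ln (1 + s) powr r \<le> s * 1" using assms by (intro mult_left_mono) auto
  also have "\<dots> \<le> exp 1" using True by simp
  finally show ?thesis using assms by (smt (verit) mult_nonneg_nonneg powr_ge_zero)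
next
  case False
  then have "1 \<le> ln (1 + s)" using assms by (simp add: ln_ge_iff)
  then have "s * ln (1 + s) powr r \<le> s * ln (1 + s) powr r'"
    using assms by (intro mult_left_mono powr_mono) auto
  then show ?thesis by (smt (verit) exp_gt_zero)
qed

lemma le_LlogL:
  fixes s r :: real
  assumes "0 \<le> s" "0 \<le> r"
  shows "s \<le> s * ln (1 + s) powr r + exp 1"
proof (cases "s = 0")
  case False
  with assms ln_powr_mono[of s 0 r] show ?thesis by simp
qed auto

lemma LlogL_mono:
  assumes f: "f \<in> LlogL r'" and r: "0 \<le> r" "r \<le> r'"
  shows "f \<in> LlogL r"
    and "(LINT \<theta>|torus. norm (f \<theta>) * ln (1 + norm (f \<theta>)) powr r)
      \<le> (LINT \<theta>|torus. norm (f \<theta>) * ln (1 + norm (f \<theta>)) powr r') + exp 1"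
proof -
  have [measurable]: "f \<in> borel_measurable torus" and
    int': "integrable torus (\<lambda>\<theta>. norm (f \<theta>) * ln (1 + norm (f \<theta>)) powr r' + exp 1)"
    using f by (auto simp: LlogL_def)
  have int: "integrable torus (\<lambda>\<theta>. norm (f \<theta>) * ln (1 + norm (f \<theta>)) powr r)"
    by (rule Bochner_Integration.integrable_bound[OF int'])
      (use ln_powr_mono[OF norm_ge_zero r] in \<open>auto intro!: AE_I2 order.trans[OF _ abs_ge_self] simp: abs_mult\<close>)
  then show "f \<in> LlogL r" by (simp add: LlogL_def)
  have "(LINT \<theta>|torus. norm (f \<theta>) * ln (1 + norm (f \<theta>)) powr r)
      \<le> (LINT \<theta>|torus. norm (f \<theta>) * ln (1 + norm (f \<theta>)) powr r' + exp 1)"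
    by (intro integral_mono int int' ln_powr_mono) (use r in auto)
  also have "\<dots> = (LINT \<theta>|torus. norm (f \<theta>) * ln (1 + norm (f \<theta>)) powr r') + exp 1"
    using f by (subst Bochner_Integration.integral_add) (auto simp: LlogL_def)
  finally show "(LINT \<theta>|torus. norm (f \<theta>) * ln (1 + norm (f \<theta>)) powr r)
      \<le> (LINT \<theta>|torus. norm (f \<theta>) * ln (1 + norm (f \<theta>)) powr r') + exp 1" .
qed

lemma LlogL_integrable:
  assumes f: "f \<in> LlogL r" and r: "0 \<le> r"
  shows "integrable torus f"
proof -
  have "integrable torus (\<lambda>\<theta>. norm (f \<theta>) * ln (1 + norm (f \<theta>)) powr r + exp 1)"
    using f by (auto simp: LlogL_def)
  then show ?thesis
    by (rule Bochner_Integration.integrable_bound)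
      (use f le_LlogL[OF norm_ge_zero r] in \<open>auto simp: LlogL_def intro!: AE_I2 order.trans[OF _ abs_ge_self]\<close>)
qed

text \<open>Duality with an extremal test function: the coefficients of \<open>P\<close> are the
  Fourier coefficients of \<open>f\<close> itself, normalised, so that the pairing of
  \<open>f\<close> with \<open>P\<close> equals \<open>sqrt s\<close>. Integrating
  \<open>young_LlogL\<close> with t = |P| bounds the pairing. The moment series is at most 2, which
  gives the summand \<open>2 * young_const K * exp 1\<close>.\<close>

lemma sum_fourier_coeff_dissociated_le:
  fixes v :: "'b \<Rightarrow> int ^ 'n"
  assumes f: "f \<in> LlogL (real K / 2)" and K: "1 \<le> K" and fin: "finite I" and dis: "dissociated I v"
  defines "C \<equiv> young_const K * (LINT \<theta>|torus. norm (f \<theta>) * ln (1 + norm (f \<theta>)) powr (real K / 2))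
      + 2 * young_const K * exp 1"
  shows "(\<Sum>A\<in>{A. A \<subseteq> I \<and> card A \<le> K}. (norm (fourier_coeff f (\<Sum>b\<in>A. v b)))\<^sup>2) \<le> C\<^sup>2"
proof -
  define y where "y = young_const K"
  have y: "0 < y" unfolding y_def by (rule young_const_pos)
  define V where "V A = (\<Sum>b\<in>A. v b)" for A
  define s where "s = (\<Sum>A\<in>{A. A \<subseteq> I \<and> card A \<le> K}. (norm (fourier_coeff f (V A)))\<^sup>2)"
  define a where "a A = (if card A \<le> K then fourier_coeff f (V A) / sqrt s else 0)" for A
  define P where "P \<theta> = (\<Sum>A\<in>Pow I. a A * torus_char (V A) \<theta>)" for \<theta>
  define T where "T = (\<Sum>A\<in>Pow I. norm (a A))"
  \<comment> \<open>\<open>T\<close> bounds |P| everywhere, so one finite cutoff of the Young sum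
    works at all points of the torus and the sum can be integrated term by term.\<close>
  define N where "N = nat \<lfloor>(T / y) powr (2 / real K)\<rfloor>"
  have f_int: "integrable torus f" using f by (rule LlogL_integrable) simp
  have s_nonneg: "0 \<le> s" unfolding s_def by (rule sum_nonneg) auto
  have X_int: "integrable torus (\<lambda>\<theta>. norm (f \<theta>) * ln (1 + norm (f \<theta>)) powr (real K / 2))"
    using f by (simp add: LlogL_def)
  have C_nonneg: "0 \<le> C"
    unfolding C_def using y by (auto simp: y_def intro!: add_nonneg_nonneg mult_nonneg_nonneg integral_nonneg_AE)
  have filter: "(\<Sum>A\<in>Pow I. if card A \<le> K then g A else 0) = (\<Sum>A\<in>{A. A \<subseteq> I \<and> card A \<le> K}. g A)"
    for g :: "'b set \<Rightarrow> 'c::comm_monoid_add"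
    using fin by (simp add: sum.inter_filter[symmetric] Pow_def)
  have "sqrt s \<le> C"
  proof (cases "s = 0")
    case True with C_nonneg show ?thesis by simp
  next
    case False
    then have s: "0 < s" using s_nonneg by simp
    have l2: "(\<Sum>A\<in>Pow I. (norm (a A))\<^sup>2) \<le> 1"
    proof -
      have "(\<Sum>A\<in>Pow I. (norm (a A))\<^sup>2) = (\<Sum>A\<in>Pow I. if card A \<le> K then (norm (fourier_coeff f (V A)))\<^sup>2 / s else 0)"
        using s by (intro sum.cong) (auto simp: a_def norm_divide power_divide)
      also have "\<dots> = s / s"
        unfolding filter s_def sum_divide_distrib ..
      finally show ?thesis using s by simp
    qed
    have moment: "(LINT \<theta>|torus. norm (P \<theta>) ^ (2 * i)) \<le> ((4 * real i + 1) ^ K * (2 * 4 ^ K)) ^ i" for i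
      unfolding P_def V_def by (rule moment_le_dissociated[OF fin dis _ l2]) (simp add: a_def)
    have "(\<Sum>i\<le>N. (exp (1 + real K) / (y\<^sup>2 * real i ^ K)) ^ i * (LINT \<theta>|torus. norm (P \<theta>) ^ (2 * i)))
        \<le> (\<Sum>i\<le>N. (1 / 2) ^ i)"
    proof (rule sum_mono)
      fix i
      show "(exp (1 + real K) / (y\<^sup>2 * real i ^ K)) ^ i * (LINT \<theta>|torus. norm (P \<theta>) ^ (2 * i)) \<le> (1 / 2) ^ i"
      proof (cases "i = 0")
        case True then show ?thesis by simp
      next
        case False
        have "(4 * real i + 1) ^ K \<le> (5 * real i) ^ K"
          using False by (intro power_mono) auto
        then have "(4 * real i + 1) ^ K * (2 * 4 ^ K) \<le> (5 * real i) ^ K * (2 * 4 ^ K)"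
          by (rule mult_right_mono) simp
        also have "(5 * real i) ^ K * (2 * 4 ^ K) = 2 * 20 ^ K * real i ^ K"
          using power_mult_distrib[of "5 :: real" 4 K] by (simp add: power_mult_distrib)
        finally have "((4 * real i + 1) ^ K * (2 * 4 ^ K)) ^ i \<le> (2 * 20 ^ K * real i ^ K) ^ i"
          by (intro power_mono) auto
        then have "(exp (1 + real K) / (y\<^sup>2 * real i ^ K)) ^ i * (LINT \<theta>|torus. norm (P \<theta>) ^ (2 * i))
            \<le> (exp (1 + real K) / (y\<^sup>2 * real i ^ K)) ^ i * (2 * 20 ^ K * real i ^ K) ^ i"
          using order.trans[OF moment] by (intro mult_left_mono) auto
        also have "\<dots> = (exp (1 + real K) / (y\<^sup>2 * real i ^ K) * (2 * 20 ^ K * real i ^ K)) ^ i"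
          by (rule power_mult_distrib[symmetric])
        also have "exp (1 + real K) / (y\<^sup>2 * real i ^ K) * (2 * 20 ^ K * real i ^ K) = 1 / 2"
          using False by (simp add: y_def young_const_power2)
        finally show ?thesis .
      qed
    qed
    also have "(\<Sum>i\<le>N. (1 / 2 :: real) ^ i) \<le> 2"
      unfolding sum_gp0 by simp
    finally have le: "(\<Sum>i\<le>N. (exp (1 + real K) / (y\<^sup>2 * real i ^ K)) ^ i * (LINT \<theta>|torus. norm (P \<theta>) ^ (2 * i))) \<le> 2" .
    have "(LINT \<theta>|torus. f \<theta> * cnj (P \<theta>)) = (\<Sum>A\<in>Pow I. cnj (a A) * fourier_coeff f (V A))"
    proof -
      have "(LINT \<theta>|torus. f \<theta> * cnj (P \<theta>)) = (LINT \<theta>|torus. (\<Sum>A\<in>Pow I. cnj (a A) * (f \<theta> * cnj (torus_char (V A) \<theta>))))"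
        by (simp add: P_def sum_distrib_left mult_ac)
      also have "\<dots> = (\<Sum>A\<in>Pow I. cnj (a A) * fourier_coeff f (V A))"
        unfolding fourier_coeff_torus_char
        by (subst Bochner_Integration.integral_sum)
          (auto intro!: integrable_mult_right integrable_mult_cnj_torus_char f_int)
      finally show ?thesis .
    qed
    also have "\<dots> = (\<Sum>A\<in>Pow I. if card A \<le> K then of_real ((norm (fourier_coeff f (V A)))\<^sup>2 / sqrt s) else 0)"
      by (intro sum.cong refl) (simp add: a_def complex_norm_square[symmetric] mult.commute)
    also have "\<dots> = of_real (s / sqrt s)"
      unfolding filter s_def sum_divide_distrib by simp
    also have "s / sqrt s = sqrt s" using s by (simp add: real_div_sqrt)
    finally have "sqrt s = norm (LINT \<theta>|torus. f \<theta> * cnj (P \<theta>))"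
      using s by simp
    also have "\<dots> \<le> (LINT \<theta>|torus. norm (f \<theta>) * norm (P \<theta>))"
      using integral_norm_bound[of torus "\<lambda>\<theta>. f \<theta> * cnj (P \<theta>)"] by (simp add: norm_mult)
    also have "\<dots> \<le> (LINT \<theta>|torus. y * (norm (f \<theta>) * ln (1 + norm (f \<theta>)) powr (real K / 2)) +
        y * exp 1 * (\<Sum>i\<le>N. (exp (1 + real K) / (y\<^sup>2 * real i ^ K)) ^ i * norm (P \<theta>) ^ (2 * i)))"
    proof (rule integral_mono)
      have P_le: "norm (P \<theta>) \<le> T" for \<theta>
        unfolding P_def T_def by (rule norm_torus_poly_le)
      have "integrable torus (\<lambda>\<theta>. T * norm (f \<theta>))" using f_int by simp
      then show "integrable torus (\<lambda>\<theta>. norm (f \<theta>) * norm (P \<theta>))"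
      proof (rule Bochner_Integration.integrable_bound)
        have [measurable]: "f \<in> borel_measurable torus" using f_int by simp
        show "(\<lambda>\<theta>. norm (f \<theta>) * norm (P \<theta>)) \<in> borel_measurable torus"
          unfolding P_def by measurable
        show "AE \<theta> in torus. norm (norm (f \<theta>) * norm (P \<theta>)) \<le> norm (T * norm (f \<theta>))"
          using P_le by (auto intro!: AE_I2 order.trans[OF _ abs_ge_self] mult_left_mono simp: abs_mult mult.commute[of T])
      qed
      show "integrable torus (\<lambda>\<theta>. y * (norm (f \<theta>) * ln (1 + norm (f \<theta>)) powr (real K / 2)) +
        y * exp 1 * (\<Sum>i\<le>N. (exp (1 + real K) / (y\<^sup>2 * real i ^ K)) ^ i * norm (P \<theta>) ^ (2 * i)))"
        unfolding P_def
        by (intro Bochner_Integration.integrable_add integrable_mult_right X_int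
            Bochner_Integration.integrable_sum integrable_torus_poly_power)
      show "norm (f \<theta>) * norm (P \<theta>) \<le> y * (norm (f \<theta>) * ln (1 + norm (f \<theta>)) powr (real K / 2)) +
        y * exp 1 * (\<Sum>i\<le>N. (exp (1 + real K) / (y\<^sup>2 * real i ^ K)) ^ i * norm (P \<theta>) ^ (2 * i))" for \<theta>
        using young_LlogL[OF norm_ge_zero norm_ge_zero P_le y K, of "f \<theta>" \<theta>]
        unfolding N_def[symmetric] by (simp only: power_mult_distrib power_mult)
    qed
    also have "\<dots> = y * (LINT \<theta>|torus. norm (f \<theta>) * ln (1 + norm (f \<theta>)) powr (real K / 2)) +
        y * exp 1 * (\<Sum>i\<le>N. (exp (1 + real K) / (y\<^sup>2 * real i ^ K)) ^ i * (LINT \<theta>|torus. norm (P \<theta>) ^ (2 * i)))"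
      using X_int integrable_torus_poly_power[where T = "Pow I" and b = a and v = V] unfolding P_def
      by (simp add: Bochner_Integration.integral_sum)
    also have "\<dots> \<le> y * (LINT \<theta>|torus. norm (f \<theta>) * ln (1 + norm (f \<theta>)) powr (real K / 2)) + y * exp 1 * 2"
      using y le by (intro add_left_mono mult_left_mono) auto
    finally show ?thesis
      by (simp add: C_def y_def)
  qed
  then have "s \<le> C\<^sup>2" by (rule sqrt_le_D)
  then show ?thesis by (simp add: s_def V_def)
qed

section \<open>Dissociated families from doubling sequences\<close>

lemma doubling_sum_le:
  fixes lam :: "nat \<Rightarrow> nat"
  assumes "\<And>m. 2 * lam m \<le> lam (Suc m)" "s \<le> t"
  shows "lam s + (\<Sum>m\<in>{s..<t}. lam m) \<le> lam t"
  using assms(2)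
proof (induction t rule: dec_induct)
  case (step t)
  then show ?case using assms(1)[of t] by simp
qed simp

text \<open>The slack \<open>lam s\<close> is kept for the lower bound below. At ratio exactly 2 it
  is all that survives cancellation: 2^t - 2^(t-1) - ... - 2^s = 2^s.\<close>

lemma doubling_digits_upper:
  fixes lam :: "nat \<Rightarrow> nat" and \<sigma> :: "nat \<Rightarrow> int"
  assumes dbl: "\<And>m. 2 * lam m \<le> lam (Suc m)"
    and B: "B \<subseteq> {s..<t}" "s \<le> t" and \<sigma>: "\<And>m. m \<in> B \<Longrightarrow> \<sigma> m \<in> {-1, 0, 1}"
  shows "int (lam s) + \<bar>\<Sum>m\<in>B. \<sigma> m * int (lam m)\<bar> \<le> int (lam t)"
proof -
  have "\<bar>\<Sum>m\<in>B. \<sigma> m * int (lam m)\<bar> \<le> (\<Sum>m\<in>B. \<bar>\<sigma> m * int (lam m)\<bar>)"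
    by (rule sum_abs)
  also have "\<dots> \<le> (\<Sum>m\<in>B. int (lam m))"
    using \<sigma> by (intro sum_mono) fastforce
  also have "\<dots> \<le> (\<Sum>m\<in>{s..<t}. int (lam m))"
    using B by (intro sum_mono2) auto
  finally show ?thesis using doubling_sum_le[where lam = lam, OF dbl B(2)] by (simp flip: of_nat_sum)
qed

text \<open>The top digit wins: the upper bound for the remaining digits still leaves
  \<open>lam (Min B)\<close> of \<open>lam (Max B)\<close>.\<close>

lemma doubling_digits_lower:
  fixes lam :: "nat \<Rightarrow> nat" and \<sigma> :: "nat \<Rightarrow> int"
  assumes dbl: "\<And>m. 2 * lam m \<le> lam (Suc m)"
    and B: "finite B" "B \<noteq> {}" and \<sigma>: "\<And>m. m \<in> B \<Longrightarrow> \<sigma> m \<in> {-1, 1}"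
  shows "int (lam (Min B)) \<le> \<bar>\<Sum>m\<in>B. \<sigma> m * int (lam m)\<bar>"
proof -
  have Max: "Max B \<in> B" and le: "Min B \<le> Max B" using B by auto
  have "int (lam (Min B)) + \<bar>\<Sum>m\<in>B - {Max B}. \<sigma> m * int (lam m)\<bar> \<le> int (lam (Max B))"
  proof (rule doubling_digits_upper[where lam = lam, OF dbl _ le])
    show "B - {Max B} \<subseteq> {Min B..<Max B}"
      using B by (auto simp: order.not_eq_order_implies_strict)
    show "\<sigma> m \<in> {-1, 0, 1}" if "m \<in> B - {Max B}" for m
      using \<sigma>[of m] that by auto
  qed
  moreover have "(\<Sum>m\<in>B. \<sigma> m * int (lam m)) = \<sigma> (Max B) * int (lam (Max B)) + (\<Sum>m\<in>B - {Max B}. \<sigma> m * int (lam m))"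
    using B Max by (intro sum.remove)
  moreover have "\<sigma> (Max B) = -1 \<or> \<sigma> (Max B) = 1" using \<sigma>[OF Max] by auto
  ultimately show ?thesis by auto
qed

text \<open>A geometric series of ratio 1/3: 2(1/3 + 1/9 + ...) = 1, and finite partial sums stay
  strictly below.\<close>

lemma lacunary_sum_less:
  fixes w :: "nat \<Rightarrow> int"
  assumes "finite B" "\<And>b. b \<in> B \<Longrightarrow> b < t" "w t \<noteq> 0"
    and "\<And>b b'. b \<in> insert t B \<Longrightarrow> b' \<in> insert t B \<Longrightarrow> b < b' \<Longrightarrow> 3 * \<bar>w b\<bar> \<le> \<bar>w b'\<bar>"
    and "\<And>b. b \<in> B \<Longrightarrow> w b \<noteq> 0"
  shows "2 * (\<Sum>b\<in>B. \<bar>w b\<bar>) < \<bar>w t\<bar>"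
  using assms
proof (induction B arbitrary: t rule: finite_linorder_max_induct)
  case (insert x B)
  have "2 * (\<Sum>b\<in>B. \<bar>w b\<bar>) < \<bar>w x\<bar>"
    using insert.hyps insert.prems by (intro insert.IH) auto
  moreover have "3 * \<bar>w x\<bar> \<le> \<bar>w t\<bar>"
    using insert.prems by auto
  moreover have "x \<notin> B" using insert.hyps by auto
  ultimately show ?case using insert.hyps by simp
qed simp

text \<open>At the largest index with nonzero coefficient, the term has size at least |w t|, while
  all lower terms together stay below it.\<close>

lemma lacunary_combination_zero:
  fixes w \<delta> :: "nat \<Rightarrow> int"
  assumes B: "finite B" and nz: "\<And>b. b \<in> B \<Longrightarrow> w b \<noteq> 0"
    and growth: "\<And>b b'. b \<in> B \<Longrightarrow> b' \<in> B \<Longrightarrow> b < b' \<Longrightarrow> 3 * \<bar>w b\<bar> \<le> \<bar>w b'\<bar>"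
    and \<delta>: "\<And>b. b \<in> B \<Longrightarrow> \<bar>\<delta> b\<bar> \<le> 2"
    and zero: "(\<Sum>b\<in>B. \<delta> b * w b) = 0"
  shows "\<forall>b\<in>B. \<delta> b = 0"
proof (rule ccontr)
  assume "\<not> (\<forall>b\<in>B. \<delta> b = 0)"
  define D where "D = {b \<in> B. \<delta> b \<noteq> 0}"
  define t where "t = Max D"
  have D: "finite D" "D \<noteq> {}" using B \<open>\<not> _\<close> by (auto simp: D_def)
  then have t: "t \<in> D" by (simp add: t_def)
  have "(\<Sum>b\<in>D. \<delta> b * w b) = 0"
    using zero B unfolding D_def by (subst sum.mono_neutral_left[of B]) auto
  then have "\<delta> t * w t = - (\<Sum>b\<in>D - {t}. \<delta> b * w b)"
    using D t by (simp add: sum.remove)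
  then have "\<bar>\<delta> t\<bar> * \<bar>w t\<bar> \<le> (\<Sum>b\<in>D - {t}. \<bar>\<delta> b * w b\<bar>)"
    by (metis abs_minus_cancel abs_mult sum_abs)
  also have "\<dots> \<le> (\<Sum>b\<in>D - {t}. 2 * \<bar>w b\<bar>)"
    using \<delta> by (intro sum_mono) (auto simp: abs_mult D_def intro!: mult_right_mono)
  also have "\<dots> = 2 * (\<Sum>b\<in>D - {t}. \<bar>w b\<bar>)"
    by (simp add: sum_distrib_left)
  also have "\<dots> < \<bar>w t\<bar>"
  proof (rule lacunary_sum_less)
    show "b < t" if "b \<in> D - {t}" for b
      using that D by (auto simp: t_def order.not_eq_order_implies_strict)
  qed (use D t nz growth in \<open>auto simp: D_def\<close>)
  also have "\<dots> \<le> \<bar>\<delta> t\<bar> * \<bar>w t\<bar>"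
    using t by (intro mult_le_cancel_right1[THEN iffD2]) (auto simp: D_def)
  finally show False by simp
qed

text \<open>Each vector lives on one coordinate axis, so the relation splits into one integer
  relation per coordinate. Its coefficients, a value in {-1, 0, 1} minus one in {0, 1}, have modulus
  at most 2.\<close>

lemma dissociated_axis:
  fixes w :: "'n::finite \<times> nat \<Rightarrow> int"
  assumes I: "finite I" and nz: "\<And>q. q \<in> I \<Longrightarrow> w q \<noteq> 0"
    and growth: "\<And>j b b'. (j, b) \<in> I \<Longrightarrow> (j, b') \<in> I \<Longrightarrow> b < b' \<Longrightarrow> 3 * \<bar>w (j, b)\<bar> \<le> \<bar>w (j, b')\<bar>"
  shows "dissociated I (\<lambda>q. axis (fst q) (w q))"
  unfolding dissociated_def
proof (intro allI impI)
  fix A and \<epsilon> :: "'n \<times> nat \<Rightarrow> int"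
  assume A: "A \<subseteq> I" and \<epsilon>: "\<epsilon> \<in> I \<rightarrow>\<^sub>E {-1, 0, 1}"
    and eq: "(\<Sum>q\<in>I. \<epsilon> q *s axis (fst q) (w q)) = (\<Sum>q\<in>A. axis (fst q) (w q))"
  define \<delta> where "\<delta> q = \<epsilon> q - of_bool (q \<in> A)" for q
  have zero: "(\<Sum>q\<in>I. \<delta> q * (axis (fst q) (w q) $ j)) = 0" for j
  proof -
    have "(\<Sum>q\<in>A. axis (fst q) (w q)) = (\<Sum>q\<in>I. if q \<in> A then axis (fst q) (w q) else 0)"
      using A I by (simp add: sum.inter_restrict[symmetric] Int_absorb1)
    then have "(\<Sum>q\<in>I. \<epsilon> q *s axis (fst q) (w q)) $ j = (\<Sum>q\<in>I. if q \<in> A then axis (fst q) (w q) else 0) $ j"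
      using eq by simp
    then have "(\<Sum>q\<in>I. \<epsilon> q * (axis (fst q) (w q) $ j)) = (\<Sum>q\<in>I. of_bool (q \<in> A) * (axis (fst q) (w q) $ j))"
      by (simp add: if_distrib[where f = "\<lambda>x. x $ j"] of_bool_def if_distrib[where f = "\<lambda>x. x * _"] cong: if_cong)
    then show ?thesis by (simp add: \<delta>_def left_diff_distrib sum_subtractf)
  qed
  show "\<forall>q\<in>I. \<epsilon> q = of_bool (q \<in> A)"
  proof (clarify)
    fix j b assume jb: "(j, b) \<in> I"
    let ?B = "{b. (j, b) \<in> I}"
    have "Pair j ` ?B \<subseteq> I" by auto
    then have finB: "finite ?B" using I by (meson finite_imageD finite_subset inj_onI prod.inject)
    have "(\<Sum>q\<in>I. \<delta> q * (axis (fst q) (w q) $ j)) = (\<Sum>q\<in>Pair j ` ?B. \<delta> q * (axis (fst q) (w q) $ j))"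
      using I by (intro sum.mono_neutral_right) (auto simp: axis_def)
    also have "\<dots> = (\<Sum>b\<in>?B. \<delta> (j, b) * w (j, b))"
      by (subst sum.reindex) (auto simp: inj_on_def axis_def)
    finally have "(\<Sum>b\<in>?B. \<delta> (j, b) * w (j, b)) = 0" using zero by simp
    moreover have "\<bar>\<delta> (j, b)\<bar> \<le> 2" if "b \<in> ?B" for b
      using that \<epsilon> PiE_mem[OF \<epsilon>, of "(j, b)"] by (auto simp: \<delta>_def)
    ultimately have "\<forall>b\<in>?B. \<delta> (j, b) = 0"
      using nz growth by (intro lacunary_combination_zero[OF finB, of "\<lambda>b. w (j, b)"]) auto
    with jb show "\<epsilon> (j, b) = of_bool ((j, b) \<in> A)" by (simp add: \<delta>_def)
  qed
qed

text \<open>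
  The digit positions \<open>(j, m)\<close> are grouped into blocks of length \<open>L\<close>, shifted by \<open>h\<close>. The first
  two positions of each block are discarded, so that sums over different blocks of digits in
  \<open>{-1, 0, 1}\<close> grow at least by a factor \<open>4\<close>, although the sequences are only assumed to double.
\<close>
definition block :: "nat \<Rightarrow> nat \<Rightarrow> 'n \<times> nat \<Rightarrow> 'n \<times> nat" where
  "block L h p = (fst p, (snd p + h) div L)"

definition block_sum ::
  "('n \<Rightarrow> nat \<Rightarrow> nat) \<Rightarrow> nat \<Rightarrow> nat \<Rightarrow> ('n \<times> nat) set \<Rightarrow> ('n \<times> nat \<Rightarrow> int) \<Rightarrow> 'n \<times> nat \<Rightarrow> int" where
  "block_sum \<Lambda> L h J \<sigma> q =
     (\<Sum>p\<in>{p \<in> J. 2 \<le> (snd p + h) mod L \<and> block L h p = q}. \<sigma> p * int (\<Lambda> (fst p) (snd p)))"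

locale doubling =
  fixes \<Lambda> :: "'n::finite \<Rightarrow> nat \<Rightarrow> nat"
  assumes dbl: "2 * \<Lambda> j m \<le> \<Lambda> j (Suc m)"
begin

lemma mono: "mono (\<Lambda> j)"
proof (rule monoI)
  fix s t :: nat assume "s \<le> t"
  then show "\<Lambda> j s \<le> \<Lambda> j t" using doubling_sum_le[where lam = "\<Lambda> j", OF dbl, of s t] by linarith
qed

text \<open>A block sum whose last nonzero digit is at t is at most the entry at t + 1; one whose
  first nonzero digit is at s is at least the entry at s. Distinct blocks give s at least t + 3,
  hence two doublings in between. Vanishing block sums are left out because a zero vector could take
  any coefficient.\<close>

lemma dissociated_block_sum:
  assumes J: "finite J" and \<sigma>: "\<And>p. p \<in> J \<Longrightarrow> \<sigma> p \<in> {-1, 0, 1}"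
  shows "finite {q. block_sum \<Lambda> L h J \<sigma> q \<noteq> 0}" (is "finite ?I")
    and "dissociated {q. block_sum \<Lambda> L h J \<sigma> q \<noteq> 0} (\<lambda>q. axis (fst q) (block_sum \<Lambda> L h J \<sigma> q))"
proof -
  let ?w = "block_sum \<Lambda> L h J \<sigma>"
  have "?w q = 0" if "q \<notin> block L h ` J" for q
  proof -
    have "{p \<in> J. 2 \<le> (snd p + h) mod L \<and> block L h p = q} = {}" using that by auto
    then show ?thesis unfolding block_sum_def by (metis sum.empty)
  qed
  then have "?I \<subseteq> block L h ` J" by auto
  then show fin: "finite ?I" using J by (meson finite_imageI finite_subset)
  define B where "B j b = {m. (j, m) \<in> J \<and> 2 \<le> (m + h) mod L \<and> (m + h) div L = b \<and> \<sigma> (j, m) \<noteq> 0}" for j b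
  have finB: "finite (B j b)" for j b
  proof -
    have "Pair j ` B j b \<subseteq> J" by (auto simp: B_def)
    then show ?thesis using J by (meson finite_imageD finite_subset inj_onI prod.inject)
  qed
  have wB: "?w (j, b) = (\<Sum>m\<in>B j b. \<sigma> (j, m) * int (\<Lambda> j m))" for j b
  proof -
    have "?w (j, b) = (\<Sum>p\<in>Pair j ` B j b. \<sigma> p * int (\<Lambda> (fst p) (snd p)))"
      unfolding block_sum_def using J
      by (intro sum.mono_neutral_right) (auto simp: B_def block_def)
    also have "\<dots> = (\<Sum>m\<in>B j b. \<sigma> (j, m) * int (\<Lambda> j m))"
      by (subst sum.reindex) (auto simp: inj_on_def)
    finally show ?thesis .
  qed
  have \<sigma>B: "\<sigma> (j, m) \<in> {-1, 1}" if "m \<in> B j b" for j b m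
    using that \<sigma>[of "(j, m)"] by (auto simp: B_def)
  show "dissociated ?I (\<lambda>q. axis (fst q) (?w q))"
  proof (rule dissociated_axis[OF fin])
    fix j b b' assume jb: "(j, b) \<in> ?I" "(j, b') \<in> ?I" and less: "b < b'"
    have ne: "B j b \<noteq> {}" "B j b' \<noteq> {}" using jb by (auto simp: wB)
    define s t where "s = Min (B j b')" and "t = Max (B j b)"
    have s: "s \<in> B j b'" and t: "t \<in> B j b" using ne finB by (auto simp: s_def t_def)
    have L: "2 < L"
    proof -
      have "2 \<le> (s + h) mod L" using s by (simp add: B_def)
      then show ?thesis
      \<comment> \<open>Division by zero gives 0, so for \<open>L = 0\<close> every position would
        lie in block 0, contradicting b < b'.\<close>
      proof (cases "L = 0")
        case True
        then have "b = 0" "b' = 0" using s t by (auto simp: B_def)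
        with less show ?thesis by simp
      next
        case False
        then have "(s + h) mod L < L" by simp
        with \<open>2 \<le> (s + h) mod L\<close> show ?thesis by linarith
      qed
    qed
    have "s + h = b' * L + (s + h) mod L"
      using s by (auto simp: B_def)
    moreover have "t + h = b * L + (t + h) mod L"
      using t by (auto simp: B_def)
    moreover have "(t + h) mod L < L" using L by simp
    moreover have "2 \<le> (s + h) mod L" using s by (simp add: B_def)
    moreover have "b * L + L \<le> b' * L"
      using less by (metis Suc_leI add.commute mult_Suc mult_le_mono1)
    \<comment> \<open>Residues stop at L - 1 in the lower block and start at 2 in the higher
      one.\<close>
    ultimately have st: "t + 3 \<le> s" by linarith
    have "\<bar>?w (j, b)\<bar> \<le> int (\<Lambda> j (Suc t))"
    proof -
      have "int (\<Lambda> j (Min (B j b))) + \<bar>\<Sum>m\<in>B j b. \<sigma> (j, m) * int (\<Lambda> j m)\<bar> \<le> int (\<Lambda> j (Suc t))"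
      proof (rule doubling_digits_upper[where lam = "\<Lambda> j", OF dbl])
        show "B j b \<subseteq> {Min (B j b)..<Suc t}"
          using finB by (auto simp: t_def less_Suc_eq_le)
        show "Min (B j b) \<le> Suc t" using finB t by (simp add: le_SucI)
      qed (use \<sigma>B in blast)
      then show ?thesis by (simp add: wB)
    qed
    moreover have "int (\<Lambda> j s) \<le> \<bar>?w (j, b')\<bar>"
      unfolding wB s_def by (rule doubling_digits_lower[where lam = "\<Lambda> j", OF dbl finB ne(2)]) (rule \<sigma>B)
    moreover have "4 * \<Lambda> j (Suc t) \<le> \<Lambda> j s"
    proof -
      have "4 * \<Lambda> j (Suc t) \<le> \<Lambda> j (t + 3)"
        using dbl[of j "Suc t"] dbl[of j "Suc (Suc t)"] by (simp add: eval_nat_numeral)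
      also have "\<dots> \<le> \<Lambda> j s" using mono st by (rule monoD)
      finally show ?thesis .
    qed
    ultimately show "3 * \<bar>?w (j, b)\<bar> \<le> \<bar>?w (j, b')\<bar>" by linarith
  qed auto
qed

end

text \<open>A position lands on one of the two discarded residues for at most two offsets, so K
  positions spoil at most 2K of the 2K + 1 offsets.\<close>

lemma exists_good_offset:
  assumes D: "finite D" "card D \<le> K"
  shows "\<exists>h<2 * K + 1. \<forall>p\<in>D. 2 \<le> (snd p + h) mod (2 * K + 1)"
proof (rule ccontr)
  let ?L = "2 * K + 1"
  assume "\<not> ?thesis"
  then have sub: "{..<?L} \<subseteq> (\<Union>p\<in>D. {h. h < ?L \<and> (snd p + h) mod ?L < 2})" by fastforce
  have card2: "card {h. h < ?L \<and> (m + h) mod ?L < 2} \<le> 2" for m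
  proof -
    have "card {h. h < ?L \<and> (m + h) mod ?L < 2} \<le> card {..<2::nat}"
    proof (rule card_inj_on_le)
      show "inj_on (\<lambda>h. (m + h) mod ?L) {h. h < ?L \<and> (m + h) mod ?L < 2}"
      proof (rule inj_onI)
        have le: "h = h'" if "h \<le> h'" "h' < ?L" "(m + h') mod ?L = (m + h) mod ?L" for h h'
        proof -
          have "?L dvd (m + h') - (m + h)"
            using that by (subst mod_eq_dvd_iff_nat[symmetric]) auto
          then show ?thesis using that by (auto dest: dvd_imp_le)
        qed
        fix h h' assume "h \<in> {h. h < ?L \<and> (m + h) mod ?L < 2}" "h' \<in> {h. h < ?L \<and> (m + h) mod ?L < 2}"
          and "(m + h) mod ?L = (m + h') mod ?L"
        then show "h = h'" using le[of h h'] le[of h' h] by (cases "h \<le> h'") auto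
      qed
    qed auto
    then show ?thesis by simp
  qed
  have "?L \<le> card (\<Union>p\<in>D. {h. h < ?L \<and> (snd p + h) mod ?L < 2})"
    using card_mono[OF _ sub] D by simp
  also have "\<dots> \<le> (\<Sum>p\<in>D. card {h. h < ?L \<and> (snd p + h) mod ?L < 2})"
    by (rule card_UN_le[OF D(1)])
  also have "\<dots> \<le> (\<Sum>p\<in>D. 2)" by (intro sum_mono card2)
  finally show False using D by simp
qed

lemma card_div_block_le:
  assumes "0 < L"
  shows "finite {m. (m + h) div L = c}" "card {m. (m + h) div L = (c::nat)} \<le> L"
proof -
  have inj: "inj_on (\<lambda>m. m + h) {m. (m + h) div L = c}" by auto
  have sub: "(\<lambda>m. m + h) ` {m. (m + h) div L = c} \<subseteq> {c * L..<c * L + L}"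
  proof clarify
    fix m
    have "m + h = (m + h) div L * L + (m + h) mod L" "(m + h) mod L < L" using assms by auto
    then show "m + h \<in> {(m + h) div L * L..<(m + h) div L * L + L}" by (metis atLeastLessThan_iff le_add1 add_less_cancel_left)
  qed
  show "finite {m. (m + h) div L = c}"
    using finite_imageD[OF finite_subset[OF sub] inj] by simp
  show "card {m. (m + h) div L = c} \<le> L"
    using card_inj_on_le[OF inj sub] by simp
qed

section \<open>Covering the frequencies\<close>

definition digit_vec :: "('n::finite \<Rightarrow> nat \<Rightarrow> nat) \<Rightarrow> 'n \<times> nat \<Rightarrow> int \<Rightarrow> int ^ 'n" where
  "digit_vec \<Lambda> p e = axis (fst p) (e * int (\<Lambda> (fst p) (snd p)))"

text \<open>Strict monotonicity makes the chosen positions distinct, so the sum can be indexed by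
  position instead of by rank. The digit 0 makes \<open>d\<close> total.\<close>

lemma signed_sums_digits:
  assumes "x \<in> signed_sums lam k"
  shows "\<exists>D d. finite D \<and> card D \<le> k \<and> (\<forall>m. d m \<in> {-1, 0, 1}) \<and> x = (\<Sum>m\<in>D. d m * int (lam m))"
proof -
  obtain \<epsilon> m where \<epsilon>: "\<forall>i<k. \<epsilon> i \<in> {1, -1}" and m: "strict_antimono_on {..<k} m"
    and x: "x = (\<Sum>i<k. \<epsilon> i * int (lam (m i)))"
    using assms by (auto simp: signed_sums_def)
  have inj: "inj_on m {..<k}"
  proof (rule linorder_inj_onI)
    fix i j assume "i < j" "i \<in> {..<k}" "j \<in> {..<k}"
    then show "m i \<noteq> m j" using monotone_onD[OF m] by fastforce
  qed (rule linear)
  define d where "d a = (if a \<in> m ` {..<k} then \<epsilon> (the_inv_into {..<k} m a) else 0)" for a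
  have dm: "d (m i) = \<epsilon> i" if "i < k" for i
    using that inj by (simp add: d_def the_inv_into_f_f)
  have "x = (\<Sum>a\<in>m ` {..<k}. d a * int (lam a))"
    unfolding x by (subst sum.reindex[OF inj]) (auto simp: dm intro!: sum.cong)
  moreover have "card (m ` {..<k}) \<le> k" using card_image_le[of "{..<k}" m] by simp
  moreover have "d a \<in> {-1, 0, 1}" for a
    using \<epsilon> inj by (auto simp: d_def the_inv_into_f_f)
  ultimately show ?thesis by blast
qed

lemma frequency_digits:
  fixes n :: "int ^ 'n"
  assumes "\<forall>j. n $ j \<in> signed_sums (\<Lambda> j) (k j)"
  shows "\<exists>D d. finite D \<and> card D \<le> (\<Sum>j\<in>UNIV. k j) \<and> (\<forall>p. d p \<in> {-1, 0, 1}) \<and>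
    n = (\<Sum>p\<in>D. digit_vec \<Lambda> p (d p))"
proof -
  have "\<forall>j. \<exists>D d. finite D \<and> card D \<le> k j \<and> (\<forall>m. d m \<in> {-1, 0, 1}) \<and>
      n $ j = (\<Sum>m\<in>D. d m * int (\<Lambda> j m))"
    using assms signed_sums_digits by blast
  then obtain D d where D: "\<And>j. finite (D j)" "\<And>j. card (D j) \<le> k j" "\<And>j m. d j m \<in> {-1, 0, 1}"
    and n: "\<And>j. n $ j = (\<Sum>m\<in>D j. d j m * int (\<Lambda> j m))"
    by metis
  let ?D = "SIGMA j:UNIV. D j"
  have "card ?D \<le> (\<Sum>j\<in>UNIV. k j)"
    using D by (subst card_SigmaI) (auto intro: sum_mono)
  moreover have "n = (\<Sum>p\<in>?D. digit_vec \<Lambda> p (d (fst p) (snd p)))"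
  proof -
    have "(\<Sum>p\<in>?D. digit_vec \<Lambda> p (d (fst p) (snd p))) $ i = n $ i" for i
    proof -
      have "(\<Sum>p\<in>?D. digit_vec \<Lambda> p (d (fst p) (snd p))) $ i =
          (\<Sum>j\<in>UNIV. \<Sum>m\<in>D j. digit_vec \<Lambda> (j, m) (d j m) $ i)"
        using D by (subst sum.Sigma) (auto intro!: sum.cong)
      also have "\<dots> = (\<Sum>j\<in>UNIV. if j = i then n $ j else 0)"
        by (intro sum.cong) (auto simp: digit_vec_def axis_def n)
      finally show ?thesis by simp
    qed
    then show ?thesis by (simp add: vec_eq_iff)
  qed
  moreover have "finite ?D" using D by auto
  ultimately show ?thesis using D(3)
    by (intro exI[of _ ?D] exI[of _ "\<lambda>p. d (fst p) (snd p)"]) auto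
qed

lemma sum_axis_same: "(\<Sum>x\<in>X. axis i (g x)) = axis i (\<Sum>x\<in>X. g x)"
  by (auto simp: vec_eq_iff axis_def)

text \<open>If \<open>\<sigma>\<close> shows exactly the digits of \<open>D\<close> in every block
  that \<open>D\<close> meets, each of these block sums is the part of the frequency lying in that
  block. Outside these blocks \<open>\<sigma>\<close> is free, which is what makes agreement likely.
  Blocks whose sum vanishes are dropped from \<open>A\<close>.\<close>

lemma digits_in_block_sums:
  fixes \<Lambda> :: "'n::finite \<Rightarrow> nat \<Rightarrow> nat"
  assumes J: "finite J" and D: "D \<subseteq> J" and good: "\<And>p. p \<in> D \<Longrightarrow> 2 \<le> (snd p + h) mod L"
    and agree: "\<And>p. p \<in> J \<Longrightarrow> block L h p \<in> block L h ` D \<Longrightarrow> \<sigma> p = (if p \<in> D then d p else 0)"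
  defines "w \<equiv> block_sum \<Lambda> L h J \<sigma>"
  shows "\<exists>A. A \<subseteq> {q. w q \<noteq> 0} \<and> card A \<le> card D \<and>
    (\<Sum>p\<in>D. digit_vec \<Lambda> p (d p)) = (\<Sum>q\<in>A. axis (fst q) (w q))"
proof -
  let ?Q = "block L h ` D"
  let ?J = "{p \<in> J. 2 \<le> (snd p + h) mod L \<and> block L h p \<in> ?Q}"
  have finD: "finite D" using J D by (rule finite_subset[rotated])
  have "axis (fst q) (w q) = (\<Sum>p\<in>{p \<in> ?J. block L h p = q}. digit_vec \<Lambda> p (if p \<in> D then d p else 0))"
    if q: "q \<in> ?Q" for q
  proof -
    have eq: "{p \<in> J. 2 \<le> (snd p + h) mod L \<and> block L h p = q} = {p \<in> ?J. block L h p = q}"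
      using q by auto
    have "axis (fst q) (w q) = (\<Sum>p\<in>{p \<in> ?J. block L h p = q}. axis (fst q) (\<sigma> p * int (\<Lambda> (fst p) (snd p))))"
      unfolding w_def block_sum_def eq sum_axis_same ..
    also have "\<dots> = (\<Sum>p\<in>{p \<in> ?J. block L h p = q}. digit_vec \<Lambda> p (if p \<in> D then d p else 0))"
    proof (rule sum.cong[OF refl])
      fix p assume p: "p \<in> {p \<in> ?J. block L h p = q}"
      then have "fst q = fst p" by (auto simp: block_def)
      moreover have "\<sigma> p = (if p \<in> D then d p else 0)"
        by (rule agree) (use p in auto)
      ultimately show "axis (fst q) (\<sigma> p * int (\<Lambda> (fst p) (snd p))) = digit_vec \<Lambda> p (if p \<in> D then d p else 0)"
        by (simp add: digit_vec_def)
    qed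
    finally show ?thesis .
  qed
  then have "(\<Sum>q\<in>?Q. axis (fst q) (w q)) =
      (\<Sum>q\<in>?Q. \<Sum>p\<in>{p \<in> ?J. block L h p = q}. digit_vec \<Lambda> p (if p \<in> D then d p else 0))"
    by (rule sum.cong[OF refl])
  also have "\<dots> = (\<Sum>p\<in>?J. digit_vec \<Lambda> p (if p \<in> D then d p else 0))"
    using J finD by (intro sum.group) auto
  also have "\<dots> = (\<Sum>p\<in>D. digit_vec \<Lambda> p (d p))"
    using J D good by (intro sum.mono_neutral_cong_right) (auto simp: digit_vec_def vec_eq_iff axis_def)
  finally have total: "(\<Sum>p\<in>D. digit_vec \<Lambda> p (d p)) = (\<Sum>q\<in>?Q. axis (fst q) (w q))" ..
  let ?A = "{q \<in> ?Q. w q \<noteq> 0}"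
  have "(\<Sum>q\<in>?Q. axis (fst q) (w q)) = (\<Sum>q\<in>?A. axis (fst q) (w q))"
    using finD by (intro sum.mono_neutral_right) (auto simp: vec_eq_iff axis_def)
  moreover have "card ?A \<le> card D"
    by (rule order.trans[OF card_mono card_image_le[OF finD]]) (use finD in auto)
  moreover have "?A \<subseteq> {q. w q \<noteq> 0}" by blast
  ultimately show ?thesis unfolding total by blast
qed

text \<open>A probability in counting form: prescribing at most r of the ternary digits leaves a
  share of at least 3^(-r) of all choices.\<close>

lemma card_agreeing_digits:
  fixes J :: "'p set" and e :: "'p \<Rightarrow> int"
  assumes J: "finite J" and U: "card U \<le> r" "U \<subseteq> J" and e: "\<And>p. e p \<in> {-1, 0, 1}"
  shows "3 ^ card J \<le> 3 ^ r * card {\<sigma> \<in> J \<rightarrow>\<^sub>E {-1, 0, 1}. \<forall>p\<in>U. \<sigma> p = e p}"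
proof -
  have eq: "{\<sigma> \<in> J \<rightarrow>\<^sub>E {-1, 0, 1}. \<forall>p\<in>U. \<sigma> p = e p} = PiE J (\<lambda>p. if p \<in> U then {e p} else {-1, 0, 1})"
    (is "?L = ?R")
  proof (intro set_eqI iffI)
    fix \<sigma> assume "\<sigma> \<in> ?L"
    then show "\<sigma> \<in> ?R" by (auto simp: PiE_iff split: if_splits)
  next
    fix \<sigma> assume \<sigma>: "\<sigma> \<in> ?R"
    then have *: "\<sigma> p \<in> (if p \<in> U then {e p} else {-1, 0, 1})" if "p \<in> J" for p using that by (rule PiE_mem)
    have "\<sigma> p \<in> {-1, 0, 1}" if "p \<in> J" for p using *[OF that] e[of p] by (auto split: if_splits)
    moreover have "\<sigma> p = e p" if "p \<in> U" for p using *[of p] that U(2) by auto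
    ultimately show "\<sigma> \<in> ?L" using \<sigma> by (auto simp: PiE_def)
  qed
  have "card {\<sigma> \<in> J \<rightarrow>\<^sub>E {-1, 0, 1}. \<forall>p\<in>U. \<sigma> p = e p} = (\<Prod>p\<in>J. if p \<in> U then 1 else 3)"
    unfolding eq using J by (subst card_PiE) (auto intro!: prod.cong)
  also have "\<dots> = 3 ^ card (J - U)"
    using J by (simp add: prod.If_cases Diff_eq)
  also have "card (J - U) = card J - card U"
    using J U by (intro card_Diff_subset) (auto intro: finite_subset)
  finally have "3 ^ r * card {\<sigma> \<in> J \<rightarrow>\<^sub>E {-1, 0, 1}. \<forall>p\<in>U. \<sigma> p = e p} = 3 ^ (r + (card J - card U))"
    by (simp add: power_add)
  moreover have "(3::nat) ^ card J \<le> 3 ^ (r + (card J - card U))"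
    using U by (intro power_increasing) auto
  ultimately show ?thesis by simp
qed

text \<open>The number of offsets, times the reciprocal of the least probability that random digits
  are right on K blocks of 2K + 1 positions.\<close>

definition cover_const :: "nat \<Rightarrow> nat" where
  "cover_const K = (2 * K + 1) * 3 ^ (K * (2 * K + 1))"

context doubling
begin

text \<open>Averaging over pairs of an offset and a digit choice. Each pair yields a dissociated
  family whose sums contribute at most \<open>C\<close>, and each frequency is caught by at least
  the share 1 / \<open>cover_const K\<close> of all pairs.\<close>

lemma sum_frequencies_le:
  fixes g :: "int ^ 'n \<Rightarrow> real" and C :: real
  assumes F: "finite F"
    and digits: "\<And>n. n \<in> F \<Longrightarrow> \<exists>D d. finite D \<and> card D \<le> K \<and> (\<forall>p. d p \<in> {-1, 0, 1}) \<and>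
      n = (\<Sum>p\<in>D. digit_vec \<Lambda> p (d p))"
    and g: "\<And>n. 0 \<le> g n"
    and dis: "\<And>I v. finite I \<Longrightarrow> dissociated I v \<Longrightarrow>
      (\<Sum>A\<in>{A. A \<subseteq> (I :: ('n \<times> nat) set) \<and> card A \<le> K}. g (\<Sum>b\<in>A. v b)) \<le> C"
  shows "(\<Sum>n\<in>F. g n) \<le> cover_const K * C"
proof -
  let ?L = "2 * K + 1"
  obtain D d where D: "\<And>n. n \<in> F \<Longrightarrow> finite (D n)" "\<And>n. n \<in> F \<Longrightarrow> card (D n) \<le> K"
    and d: "\<And>n p. n \<in> F \<Longrightarrow> d n p \<in> {-1, 0, 1 :: int}"
    and n: "\<And>n. n \<in> F \<Longrightarrow> n = (\<Sum>p\<in>D n. digit_vec \<Lambda> p (d n p))"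
    using digits by metis
  \<comment> \<open>Restricting to positions used by the finite set \<open>F\<close> makes the digit
    choices finite in number, so the average is a plain count.\<close>
  define J where "J = (\<Union>n\<in>F. D n)"
  have J: "finite J" using F D by (auto simp: J_def)
  define \<Sigma> where "\<Sigma> = J \<rightarrow>\<^sub>E {-1, 0, 1 :: int}"
  have "card \<Sigma> = card {-1, 0, 1 :: int} ^ card J"
    unfolding \<Sigma>_def using J by (simp only: card_PiE prod_constant)
  also have "card {-1, 0, 1 :: int} = 3" by simp
  finally have \<Sigma>: "finite \<Sigma>" "card \<Sigma> = 3 ^ card J"
    unfolding \<Sigma>_def using J by (simp_all add: finite_PiE)
  define w where "w h \<sigma> = block_sum \<Lambda> ?L h J \<sigma>" for h \<sigma>
  define E where "E h \<sigma> = (\<lambda>A. \<Sum>q\<in>A. axis (fst q) (w h \<sigma> q)) ` {A. A \<subseteq> {q. w h \<sigma> q \<noteq> 0} \<and> card A \<le> K}" for h \<sigma>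
  have E: "finite (E h \<sigma>)" "(\<Sum>n\<in>E h \<sigma>. g n) \<le> C" if \<sigma>: "\<sigma> \<in> \<Sigma>" for h \<sigma>
  proof -
    have \<sigma>': "\<sigma> p \<in> {-1, 0, 1}" if "p \<in> J" for p
      using \<sigma> that unfolding \<Sigma>_def by (rule PiE_mem)
    have I: "finite {q. w h \<sigma> q \<noteq> 0}" "dissociated {q. w h \<sigma> q \<noteq> 0} (\<lambda>q. axis (fst q) (w h \<sigma> q))"
      unfolding w_def by (rule dissociated_block_sum[OF J \<sigma>'], assumption)+
    have finA: "finite {A. A \<subseteq> {q. w h \<sigma> q \<noteq> 0} \<and> card A \<le> K}"
      by (rule finite_subset[of _ "Pow {q. w h \<sigma> q \<noteq> 0}"]) (use I(1) in auto)
    then show "finite (E h \<sigma>)" by (simp add: E_def)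
    show "(\<Sum>n\<in>E h \<sigma>. g n) \<le> C"
      unfolding E_def
      using sum_image_le[OF finA, of g "\<lambda>A. \<Sum>q\<in>A. axis (fst q) (w h \<sigma> q)"] dis[OF I] g
      by (simp add: o_def)
  qed
  have count: "3 ^ card J \<le> 3 ^ (K * ?L) * card {x \<in> {..<?L} \<times> \<Sigma>. m \<in> E (fst x) (snd x)}"
    if m: "m \<in> F" for m
  proof -
    obtain h where h: "h < ?L" and good: "\<And>p. p \<in> D m \<Longrightarrow> 2 \<le> (snd p + h) mod ?L"
      using exists_good_offset[OF D(1,2)[OF m]] by blast
    define e where "e p = (if p \<in> D m then d m p else 0)" for p
    \<comment> \<open>All positions of \<open>J\<close> in blocks met by \<open>D m\<close>, not
      just \<open>D m\<close>: the other digits of these blocks must be 0. There are at most K such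
      blocks.\<close>
    define U where "U = {p \<in> J. block ?L h p \<in> block ?L h ` D m}"
    have "U \<subseteq> (\<Union>p\<in>D m. Pair (fst p) ` {a. (a + h) div ?L = (snd p + h) div ?L})"
      by (force simp: U_def block_def)
    then have "card U \<le> card (\<Union>p\<in>D m. Pair (fst p) ` {a. (a + h) div ?L = (snd p + h) div ?L})"
      using D(1)[OF m] card_div_block_le(1)[of ?L h] by (intro card_mono) auto
    also have "\<dots> \<le> (\<Sum>p\<in>D m. card (Pair (fst p) ` {a. (a + h) div ?L = (snd p + h) div ?L}))"
      using D(1)[OF m] by (rule card_UN_le)
    also have "\<dots> \<le> (\<Sum>p\<in>D m. ?L)"
      using card_div_block_le(2)[of ?L h] by (intro sum_mono) (auto simp: card_image inj_on_def)
    also have "\<dots> \<le> K * ?L" using D(2)[OF m] by (simp only: sum_constant of_nat_id mult_le_mono1)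
    finally have U: "card U \<le> K * ?L" .
    have mem: "m \<in> E h \<sigma>" if \<sigma>: "\<sigma> \<in> \<Sigma>" "\<forall>p\<in>U. \<sigma> p = e p" for \<sigma>
    proof -
      have "\<exists>A. A \<subseteq> {q. w h \<sigma> q \<noteq> 0} \<and> card A \<le> card (D m) \<and>
          (\<Sum>p\<in>D m. digit_vec \<Lambda> p (d m p)) = (\<Sum>q\<in>A. axis (fst q) (w h \<sigma> q))"
        unfolding w_def
      proof (rule digits_in_block_sums[OF J])
        show "D m \<subseteq> J" using m by (auto simp: J_def)
        show "\<sigma> p = (if p \<in> D m then d m p else 0)" if "p \<in> J" "block ?L h p \<in> block ?L h ` D m" for p
          using \<sigma>(2) that unfolding U_def e_def by blast
      qed (rule good)
      then show ?thesis
        unfolding E_def using n[OF m] D(2)[OF m] by (fastforce intro: order.trans)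
    qed
    have "Pair h ` {\<sigma> \<in> \<Sigma>. \<forall>p\<in>U. \<sigma> p = e p} \<subseteq> {x \<in> {..<?L} \<times> \<Sigma>. m \<in> E (fst x) (snd x)}"
      using h mem by auto
    then have "card (Pair h ` {\<sigma> \<in> \<Sigma>. \<forall>p\<in>U. \<sigma> p = e p}) \<le> card {x \<in> {..<?L} \<times> \<Sigma>. m \<in> E (fst x) (snd x)}"
      using \<Sigma>(1) by (intro card_mono) auto
    then have "card {\<sigma> \<in> \<Sigma>. \<forall>p\<in>U. \<sigma> p = e p} \<le> card {x \<in> {..<?L} \<times> \<Sigma>. m \<in> E (fst x) (snd x)}"
      by (simp add: card_image inj_on_def)
    moreover have "3 ^ card J \<le> 3 ^ (K * ?L) * card {\<sigma> \<in> \<Sigma>. \<forall>p\<in>U. \<sigma> p = e p}"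
      unfolding \<Sigma>_def using d[OF m] by (intro card_agreeing_digits[OF J U]) (auto simp: U_def e_def)
    ultimately show ?thesis by (meson le_trans mult_le_mono2)
  qed
  let ?X = "{..<?L} \<times> \<Sigma>"
  \<comment> \<open>Double counting: exchanging the sums turns the weight of a frequency, the number
    of pairs catching it, into a sum over pairs.\<close>
  have "3 ^ card J * (\<Sum>m\<in>F. g m) \<le> (\<Sum>m\<in>F. 3 ^ (K * ?L) * (card {x \<in> ?X. m \<in> E (fst x) (snd x)} * g m))"
    unfolding sum_distrib_left
  proof (rule sum_mono)
    fix m assume "m \<in> F"
    then have "real (3 ^ card J) \<le> real (3 ^ (K * ?L) * card {x \<in> ?X. m \<in> E (fst x) (snd x)})"
      using count of_nat_le_iff by blast
    then have "real (3 ^ card J) * g m \<le> real (3 ^ (K * ?L) * card {x \<in> ?X. m \<in> E (fst x) (snd x)}) * g m"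
      using g by (rule mult_right_mono)
    then show "3 ^ card J * g m \<le> 3 ^ (K * ?L) * (card {x \<in> ?X. m \<in> E (fst x) (snd x)} * g m)"
      by (simp add: mult.assoc)
  qed
  also have "\<dots> = 3 ^ (K * ?L) * (\<Sum>m\<in>F. \<Sum>x\<in>?X. if m \<in> E (fst x) (snd x) then g m else 0)"
    using \<Sigma>(1) by (simp add: sum_distrib_left sum.inter_filter[symmetric])
  also have "\<dots> = 3 ^ (K * ?L) * (\<Sum>x\<in>?X. \<Sum>m\<in>{m \<in> F. m \<in> E (fst x) (snd x)}. g m)"
    using F by (subst sum.swap) (simp add: sum.inter_filter)
  also have "\<dots> \<le> 3 ^ (K * ?L) * (\<Sum>x\<in>?X. C)"
  proof (intro mult_left_mono sum_mono)
    fix x assume x: "x \<in> ?X"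
    then have "(\<Sum>m\<in>{m \<in> F. m \<in> E (fst x) (snd x)}. g m) \<le> (\<Sum>m\<in>E (fst x) (snd x). g m)"
      using E(1) g by (intro sum_mono2) auto
    also have "\<dots> \<le> C" using E(2) x by auto
    finally show "(\<Sum>m\<in>{m \<in> F. m \<in> E (fst x) (snd x)}. g m) \<le> C" .
  qed auto
  also have "\<dots> = 3 ^ card J * (cover_const K * C)"
    using \<Sigma>(2) by (simp add: card_cartesian_product cover_const_def algebra_simps)
  finally show ?thesis by simp
qed

end

section \<open>Explicit constants and the final inequality\<close>

lemma lacunary_doubling:
  assumes "\<forall>j. lacunary (\<Lambda> j) \<and> 2 \<le> lacunary_ratio (\<Lambda> j)"
  shows "doubling \<Lambda>"
proof
  fix j m
  have pos: "0 < \<Lambda> j m" for m using assms by (auto simp: lacunary_def)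
  have "lacunary_ratio (\<Lambda> j) \<le> real (\<Lambda> j (Suc m)) / real (\<Lambda> j m)"
    unfolding lacunary_ratio_def by (rule cINF_lower) (auto intro!: bdd_belowI[of _ 0])
  then have "2 \<le> real (\<Lambda> j (Suc m)) / real (\<Lambda> j m)"
    using assms by (meson order.trans)
  then have "2 * real (\<Lambda> j m) \<le> real (\<Lambda> j (Suc m))"
    using pos[of m] by (simp add: le_divide_eq)
  then show "2 * \<Lambda> j m \<le> \<Lambda> j (Suc m)" by linarith
qed

text \<open>The covering argument loses \<open>cover_const K\<close> on sums of squares, hence its
  square root on the norm.\<close>

definition zygmund_A :: "nat \<Rightarrow> real" where
  "zygmund_A K = sqrt (cover_const K) * young_const K"

definition zygmund_B :: "nat \<Rightarrow> real" where
  "zygmund_B K = 2 * exp 1 * zygmund_A K"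

lemma zygmund_pos: "0 < zygmund_A K" "0 < zygmund_B K"
proof -
  have "0 < cover_const K" by (simp add: cover_const_def)
  then show "0 < zygmund_A K" "0 < zygmund_B K"
    using young_const_pos[of K] by (auto simp: zygmund_A_def zygmund_B_def)
qed

text \<open>The bound is uniform over finite sets of frequencies, which gives summability and the
  bound on the infinite sum. Summability is claimed separately because \<open>infsum\<close> is 0
  for families that are not summable.\<close>

lemma zygmund_inequality:
  fixes f :: "real ^ 'n \<Rightarrow> complex"
  assumes \<Lambda>: "\<forall>j. lacunary (\<Lambda> j) \<and> 2 \<le> lacunary_ratio (\<Lambda> j)"
    and K: "1 \<le> K" "(\<Sum>j\<in>UNIV. k j) = K"
    and f: "f \<in> LlogL (real K / 2)"
  defines "M \<equiv> {m :: int ^ 'n. \<forall>j. m $ j \<in> signed_sums (\<Lambda> j) (k j)}"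
    and "X \<equiv> (LINT \<theta>|torus. norm (f \<theta>) * ln (1 + norm (f \<theta>)) powr (real K / 2))"
  shows "(\<lambda>m. (norm (fourier_coeff f m))\<^sup>2) summable_on M"
    and "sqrt (\<Sum>\<^sub>\<infinity>m\<in>M. (norm (fourier_coeff f m))\<^sup>2) \<le> zygmund_A K * X + zygmund_B K"
proof -
  interpret doubling \<Lambda> using \<Lambda> by (rule lacunary_doubling)
  define C where "C = young_const K * X + 2 * young_const K * exp 1"
  have bound: "(\<Sum>m\<in>F. (norm (fourier_coeff f m))\<^sup>2) \<le> cover_const K * C\<^sup>2"
    if F: "finite F" "F \<subseteq> M" for F
  proof (rule sum_frequencies_le[where g = "\<lambda>m. (norm (fourier_coeff f m))\<^sup>2" and C = "C\<^sup>2", OF F(1)])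
    fix m assume "m \<in> F"
    then have "\<forall>j. m $ j \<in> signed_sums (\<Lambda> j) (k j)" using F by (auto simp: M_def)
    then show "\<exists>D d. finite D \<and> card D \<le> K \<and> (\<forall>p. d p \<in> {-1, 0, 1}) \<and> m = (\<Sum>p\<in>D. digit_vec \<Lambda> p (d p))"
      using frequency_digits[of m \<Lambda> k] K by simp
  next
    fix I :: "('n \<times> nat) set" and v :: "'n \<times> nat \<Rightarrow> int ^ 'n"
    assume "finite I" "dissociated I v"
    then show "(\<Sum>A\<in>{A. A \<subseteq> I \<and> card A \<le> K}. (norm (fourier_coeff f (\<Sum>b\<in>A. v b)))\<^sup>2) \<le> C\<^sup>2"
      unfolding C_def X_def by (rule sum_fourier_coeff_dissociated_le[OF f K(1)])
  qed auto
  show summable: "(\<lambda>m. (norm (fourier_coeff f m))\<^sup>2) summable_on M"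
    by (rule nonneg_bdd_above_summable_on) (auto intro!: bdd_aboveI2 bound)
  have "(\<Sum>\<^sub>\<infinity>m\<in>M. (norm (fourier_coeff f m))\<^sup>2) \<le> cover_const K * C\<^sup>2"
    by (rule infsum_le_finite_sums[OF summable bound])
  then have "sqrt (\<Sum>\<^sub>\<infinity>m\<in>M. (norm (fourier_coeff f m))\<^sup>2) \<le> sqrt (cover_const K * C\<^sup>2)"
    by (rule real_sqrt_le_mono)
  also have "\<dots> = sqrt (cover_const K) * C"
  proof -
    have "0 \<le> X" unfolding X_def by (rule integral_nonneg_AE) auto
    then have "0 \<le> C" using young_const_pos[of K] by (auto simp: C_def)
    then show ?thesis by (simp add: real_sqrt_mult)
  qed
  also have "\<dots> = zygmund_A K * X + zygmund_B K"
    by (simp add: C_def zygmund_A_def zygmund_B_def algebra_simps)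
  finally show "sqrt (\<Sum>\<^sub>\<infinity>m\<in>M. (norm (fourier_coeff f m))\<^sup>2) \<le> zygmund_A K * X + zygmund_B K" .
qed

theorem proposition14:
  "\<exists>A B :: ('n::finite \<Rightarrow> int set) \<Rightarrow> real.
     \<forall>(\<Lambda> :: 'n \<Rightarrow> nat \<Rightarrow> nat) (k :: 'n \<Rightarrow> nat).
       (\<forall>j. lacunary (\<Lambda> j) \<and> 2 \<le> lacunary_ratio (\<Lambda> j) \<and> 1 \<le> k j) \<longrightarrow>
       (let S = (\<lambda>j. signed_sums (\<Lambda> j) (k j));
            M = {m :: int ^ 'n. \<forall>j. m $ j \<in> S j};
            r = real (\<Sum>j\<in>UNIV. k j) / 2
        in 0 < A S \<and> 0 < B S \<and>
           (\<forall>f :: real ^ 'n \<Rightarrow> complex. f \<in> LlogL r \<longrightarrow>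
              (\<lambda>m. (norm (fourier_coeff f m))\<^sup>2) summable_on M \<and>
              sqrt (\<Sum>\<^sub>\<infinity>m\<in>M. (norm (fourier_coeff f m))\<^sup>2)
                \<le> A S * (LINT \<theta>|torus. norm (f \<theta>) * ln (1 + norm (f \<theta>)) powr r) + B S))"
proof -
  \<comment> \<open>The same sets may arise from different \<open>k\<close>, hence with different exponents \<open>r\<close>, but the constants
    may depend on the sets only. The smallest exponent gives the strongest inequality.\<close>
  define rep where "rep S K \<longleftrightarrow> (\<exists>(\<Lambda> :: 'n \<Rightarrow> nat \<Rightarrow> nat) k.
      (\<forall>j. lacunary (\<Lambda> j) \<and> 2 \<le> lacunary_ratio (\<Lambda> j) \<and> 1 \<le> k j) \<and>
      S = (\<lambda>j. signed_sums (\<Lambda> j) (k j)) \<and> K = (\<Sum>j\<in>UNIV. k j))" for S K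
  define K0 where "K0 S = (LEAST K. rep S K)" for S
  define A where "A S = zygmund_A (K0 S)" for S
  \<comment> \<open>The second summand pays for raising the exponent from that of
    \<open>K0 S\<close> to the given one, which costs \<open>exp 1\<close> inside the integral
    bound.\<close>
  define B where "B S = zygmund_B (K0 S) + zygmund_A (K0 S) * exp 1" for S
  have main: "0 < A S \<and> 0 < B S \<and> (\<forall>f \<in> LlogL (real K / 2).
      (\<lambda>m. (norm (fourier_coeff f m))\<^sup>2) summable_on {m. \<forall>j. m $ j \<in> S j} \<and>
      sqrt (\<Sum>\<^sub>\<infinity>m\<in>{m. \<forall>j. m $ j \<in> S j}. (norm (fourier_coeff f m))\<^sup>2)
        \<le> A S * (LINT \<theta>|torus. norm (f \<theta>) * ln (1 + norm (f \<theta>)) powr (real K / 2)) + B S)"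
    if rep: "rep S K" for S K
  proof (intro conjI ballI)
    show "0 < A S" "0 < B S"
      using zygmund_pos[of "K0 S"] by (auto simp: A_def B_def add_pos_pos)
    fix f :: "real ^ 'n \<Rightarrow> complex" assume f: "f \<in> LlogL (real K / 2)"
    \<comment> \<open>The minimal representation may use other sequences and another
      \<open>k\<close> than the given ones; the left-hand side of the inequality sees only
      \<open>S\<close>.\<close>
    have "rep S (K0 S)" unfolding K0_def using rep by (rule LeastI)
    then obtain \<Lambda> k where \<Lambda>: "\<forall>j. lacunary (\<Lambda> j) \<and> 2 \<le> lacunary_ratio (\<Lambda> j)" and k: "\<forall>j. 1 \<le> k j"
      and S: "S = (\<lambda>j. signed_sums (\<Lambda> j) (k j))" and K0: "(\<Sum>j\<in>UNIV. k j) = K0 S"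
      unfolding rep_def by metis
    have "1 \<le> CARD('n)" by (simp add: Suc_leI)
    also have "\<dots> = (\<Sum>j\<in>(UNIV :: 'n set). 1)" by simp
    also have "\<dots> \<le> K0 S" unfolding K0[symmetric] using k by (intro sum_mono) auto
    finally have K0_1: "1 \<le> K0 S" .
    have le: "0 \<le> real (K0 S) / 2" "real (K0 S) / 2 \<le> real K / 2"
      using rep by (auto simp: K0_def intro: Least_le)
    note zyg = zygmund_inequality[OF \<Lambda> K0_1 K0 LlogL_mono(1)[OF f le]]
    show "(\<lambda>m. (norm (fourier_coeff f m))\<^sup>2) summable_on {m. \<forall>j. m $ j \<in> S j}"
      using zyg(1) by (simp add: S)
    have "sqrt (\<Sum>\<^sub>\<infinity>m\<in>{m. \<forall>j. m $ j \<in> S j}. (norm (fourier_coeff f m))\<^sup>2)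
        \<le> A S * (LINT \<theta>|torus. norm (f \<theta>) * ln (1 + norm (f \<theta>)) powr (real (K0 S) / 2)) + zygmund_B (K0 S)"
      using zyg(2) by (simp add: A_def S)
    also have "\<dots> \<le> A S * ((LINT \<theta>|torus. norm (f \<theta>) * ln (1 + norm (f \<theta>)) powr (real K / 2)) + exp 1) + zygmund_B (K0 S)"
      using LlogL_mono(2)[OF f le] zygmund_pos(1)[of "K0 S"] by (intro add_right_mono mult_left_mono) (auto simp: A_def)
    also have "\<dots> = A S * (LINT \<theta>|torus. norm (f \<theta>) * ln (1 + norm (f \<theta>)) powr (real K / 2)) + B S"
      by (simp add: A_def B_def algebra_simps)
    finally show "sqrt (\<Sum>\<^sub>\<infinity>m\<in>{m. \<forall>j. m $ j \<in> S j}. (norm (fourier_coeff f m))\<^sup>2)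
        \<le> A S * (LINT \<theta>|torus. norm (f \<theta>) * ln (1 + norm (f \<theta>)) powr (real K / 2)) + B S" .
  qed
  show ?thesis
  proof (rule exI[of _ A], rule exI[of _ B], intro allI impI)
    fix \<Lambda> :: "'n \<Rightarrow> nat \<Rightarrow> nat" and k :: "'n \<Rightarrow> nat"
    assume "\<forall>j. lacunary (\<Lambda> j) \<and> 2 \<le> lacunary_ratio (\<Lambda> j) \<and> 1 \<le> k j"
    then have "rep (\<lambda>j. signed_sums (\<Lambda> j) (k j)) (\<Sum>j\<in>UNIV. k j)"
      unfolding rep_def by blast
    from main[OF this] show "let S = (\<lambda>j. signed_sums (\<Lambda> j) (k j));
            M = {m :: int ^ 'n. \<forall>j. m $ j \<in> S j};
            r = real (\<Sum>j\<in>UNIV. k j) / 2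
        in 0 < A S \<and> 0 < B S \<and>
           (\<forall>f :: real ^ 'n \<Rightarrow> complex. f \<in> LlogL r \<longrightarrow>
              (\<lambda>m. (norm (fourier_coeff f m))\<^sup>2) summable_on M \<and>
              sqrt (\<Sum>\<^sub>\<infinity>m\<in>M. (norm (fourier_coeff f m))\<^sup>2)
                \<le> A S * (LINT \<theta>|torus. norm (f \<theta>) * ln (1 + norm (f \<theta>)) powr r) + B S)"
      unfolding Let_def Ball_def .
  qed
qed

end
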